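(* Let $\mathbb{F}_q$ be a finite field with $q$ elements, let $a,b\in\mathbb{F}_q^{\times}$, and write $t:=q^{-s}$. For the Lie algebras over $\mathbb{F}_q$ defined in the context (where for $M_a^9(\mathbb{F}_q)$ it is assumed that $x^2-x-a$ has no roots in $\mathbb{F}_q$), the subalgebra zeta functions are \begin{align*} \zeta_{M^{1}(\mathbb{F}_q)}^{\leq}(s)=&\,1+(1+q+q^2+q^3)t+(1+q+q^2)(1+q^2)t^2+(1+q+q^2+q^3)t^3+t^4,\\ \zeta_{M^{2}(\mathbb{F}_q)}^{\leq}(s)=&\,1+(1+q+q^2+q^3)t+(1+q+q^2)(1+q^2)t^2+(1+q+q^2+q^3)t^3+t^4,\\ \zeta_{M_a^3(\mathbb{F}_q)}^{\leq}(s)=&\,1+(q^2+2q+1)t+(q^3+3q^2+q+1)t^2+(1+q+q^2+q^3)t^3+t^4\quad(a\neq1),\\ \zeta_{M_1^3(\mathbb{F}_q)}^{\leq}(s)=&\,1+(q^2+q+1)t+(q^3+2q^2+q+1)t^2+(1+q+q^2+q^3)t^3+t^4,\\ \zeta_{M_0^{3}(\mathbb{F}_q)}^{\leq}(s)=&\,1+(q^2+2q+1)t+(q^3+3q^2+q+1)t^2+(1+q+q^2+q^3)t^3+t^4,\\ \zeta_{M^{4}(\mathbb{F}_q)}^{\leq}(s)=&\,1+(q^2+2q+1)t+(q^3+3q^2+q+1)t^2+(1+q+q^2+q^3)t^3+t^4,\\ \zeta_{M^{5}(\mathbb{F}_q)}^{\leq}(s)=&\,1+(q^2+q+1)t+(q^3+2q^2+q+1)t^2+(1+q+q^2+q^3)t^3+t^4,\\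 \zeta_{M_{a,b}^6(\mathbb{F}_q)}^{\leq}(s)=&\,1+(1+q|V_{6,a,b}^{(2)}(\mathbb{F}_q)|)t+\bigl(1+q+q^2+(q^2-1)|V_{6,a,b}^{(3)}(\mathbb{F}_q)|+|V_{6,a,b}^{(1)}(\mathbb{F}_q)|\bigr)t^2\\ &+(1+q+q^2+q^3)t^3+t^4\quad(a\neq-b),\\ \zeta_{M_{a,-a}^6(\mathbb{F}_q)}^{\leq}(s)=&\,1+(1+q|V_{6,a,-a}^{(2)}(\mathbb{F}_q)|)t+\bigl(1+q+q^2+(q^2-1)(1+|V_{6,a,-a}^{(4)}(\mathbb{F}_q)|)+|V_{6,a,-a}^{(1)}(\mathbb{F}_q)|\bigr)t^2\\ &+(1+q+q^2+q^3)t^3+t^4,\\ \zeta_{M_{a,0}^{6}(\mathbb{F}_q)}^{\leq}(s)=&\,1+(1+q|V_{6,a,0}^{(2)}(\mathbb{F}_q)|)t+\bigl(1+q+q^2+(q^2-1)|V_{6,a,0}^{(2)}(\mathbb{F}_q)|+|V_{6,a,0}^{(1)}(\mathbb{F}_q)|\bigr)t^2\\ &+(1+q+q^2+q^3)t^3+t^4,\\ \zeta_{M_{0,b}^{6}(\mathbb{F}_q)}^{\leq}(s)=&\,1+(1+q+q|V_{3,b}(\mathbb{F}_q)|)t+(1+q+2q^2+q^2|V_{3,b}(\mathbb{F}_q)|)t^2+(1+q+q^2+q^3)t^3+t^4,\\ \zeta_{M_{0,0}^{6}(\mathbb{F}_q)}^{\leq}(s)=&\,1+(1+2q)t+(1+q+3q^2)t^2+(1+q+q^2+q^3)t^3+t^4,\\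 \zeta_{M_{a,b}^7(\mathbb{F}_q)}^{\leq}(s)=&\,1+(1+q|V_{7,a,b}^{(2)}(\mathbb{F}_q)|)t+\bigl(1+q+q^2+(q^2-1)|V_{7,a,b}^{(3)}(\mathbb{F}_q)|+|V_{7,a,b}^{(1)}(\mathbb{F}_q)|\bigr)t^2\\ &+(1+q+q^2+q^3)t^3+t^4,\\ \zeta_{M_{a,0}^7(\mathbb{F}_q)}^{\leq}(s)=&\,1+(1+q|V_{7,a,0}^{(2)}(\mathbb{F}_q)|)t+\bigl(1+q+q^2+(q^2-1)|V_{7,a,0}^{(2)}(\mathbb{F}_q)|+|V_{7,a,0}^{(1)}(\mathbb{F}_q)|\bigr)t^2\\ &+(1+q+q^2+q^3)t^3+t^4,\\ \zeta_{M_{0,b}^7(\mathbb{F}_q)}^{\leq}(s)=&\,1+(1+q+q|V_{4,b}(\mathbb{F}_q)|)t+(1+q+2q^2+q^2|V_{4,b}(\mathbb{F}_q)|)t^2+(1+q+q^2+q^3)t^3+t^4,\\ \zeta_{M_{0,0}^7(\mathbb{F}_q)}^{\leq}(s)=&\,1+(1+q)t+(1+q+2q^2)t^2+(1+q+q^2+q^3)t^3+t^4,\\ \zeta_{M^{8}(\mathbb{F}_q)}^{\leq}(s)=&\,1+(1+3q)t+(1+q+4q^2)t^2+(1+q+q^2+q^3)t^3+t^4,\\ \zeta_{M_{a}^{9}(\mathbb{F}_q)}^{\leq}(s)=&\,1+(1+q)t+(1+q+2q^2)t^2+(1+q+q^2+q^3)t^3+t^4,\\ \zeta_{M^{12}(\mathbb{F}_q)}^{\leq}(s)=&\,1+(1+q+q^2)t+(1+q+2q^2+q^3)t^2+(1+q+q^2+q^3)t^3+t^4,\\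 \zeta_{M_{a}^{13}(\mathbb{F}_q)}^{\leq}(s)=&\,1+(1+q|V_{13,a}(\mathbb{F}_q)|)t+(1+q+q^2+q^2|V_{13,a}(\mathbb{F}_q)|)t^2+(1+q+q^2+q^3)t^3+t^4,\\ \zeta_{M_{0}^{13}(\mathbb{F}_q)}^{\leq}(s)=&\,1+(2q+1)t+(3q^2+q+1)t^2+(1+q+q^2+q^3)t^3+t^4,\\ \zeta_{M_{a}^{14}(\mathbb{F}_q)}^{\leq}(s)=&\,1+(1+q|V_{14,a}(\mathbb{F}_q)|)t+(1+q+q^2+q^2|V_{14,a}(\mathbb{F}_q)|)t^2+(1+q+q^2+q^3)t^3+t^4. \end{align*}
   Context: For a Lie algebra $L$ over $\mathbb{F}_q$ of finite dimension $n$, the subalgebra zeta function is $\zeta_L^{\leq}(s)=\sum_{i=0}^{n}a^{\leq}_{q^i}(L)\,t^{i}$, where $t=q^{-s}$ and $a^{\leq}_{q^i}(L)$ is the number of Lie subalgebras of $L$ (over $\mathbb{F}_q$) of codimension $i$ (index $q^i$). All Lie algebras below are 4-dimensional over $\mathbb{F}_q$ with basis $e_1,e_2,e_3,e_4$; up to antisymmetry all brackets of basis elements that are not listed are zero. Parameters $a,b$ lie in $\mathbb{F}_q$. - $M^1$: abelian. - $M^2$: $[e_4,e_1]=e_1$, $[e_4,e_2]=e_2$, $[e_4,e_3]=e_3$. - $M_a^3$: $[e_4,e_1]=e_1$, $[e_4,e_2]=e_3$, $[e_4,e_3]=-ae_2+(a+1)e_3$. - $M^4$: $[e_4,e_2]=e_3$,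 $[e_4,e_3]=e_3$. - $M^5$: $[e_4,e_2]=e_3$. - $M_{a,b}^6$: $[e_4,e_1]=e_2$, $[e_4,e_2]=e_3$, $[e_4,e_3]=ae_1+be_2+e_3$. - $M_{a,b}^7$: $[e_4,e_1]=e_2$, $[e_4,e_2]=e_3$, $[e_4,e_3]=ae_1+be_2$. - $M^8$: $[e_1,e_2]=e_2$, $[e_3,e_4]=e_4$. - $M_a^9$ (defined only for $a$ such that $x^2-x-a$ has no roots in $\mathbb{F}_q$): $[e_4,e_1]=e_1+ae_2$, $[e_4,e_2]=e_1$, $[e_3,e_1]=e_1$, $[e_3,e_2]=e_2$. - $M^{12}$: $[e_4,e_1]=e_1$, $[e_4,e_2]=2e_2$, $[e_4,e_3]=e_3$, $[e_3,e_1]=e_2$. - $M_a^{13}$: $[e_4,e_1]=e_1+ae_3$, $[e_4,e_2]=e_2$, $[e_4,e_3]=e_1$, $[e_3,e_1]=e_2$. - $M_a^{14}$: $[e_4,e_1]=ae_3$, $[e_4,e_3]=e_1$, $[e_3,e_1]=e_2$. The point counts are: $|V_{3,a}(\mathbb{F}_q)|=|\{x\in\mathbb{F}_q:ax^2-x-1=0\}|$, $|V_{4,a}(\mathbb{F}_q)|=|\{x\in\mathbb{F}_q:ax^2-1=0\}|$, $|V_{6,a,b}^{(1)}(\mathbb{F}_q)|=|\{x\in\mathbb{F}_q:-a^2x^3+ax^2+bx+1=0\}|$, $|V_{6,a,b}^{(2)}(\mathbb{F}_q)|=|\{x\in\mathbb{F}_q:ax^3-bx^2+x+1=0\}|$,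 $|V_{6,a,b}^{(3)}(\mathbb{F}_q)|=|\{x\in\mathbb{F}_q:(a+b)x^3+(a+b^2)x^2+2abx+a^2=0\}|$, $|V_{6,a,b}^{(4)}(\mathbb{F}_q)|=|\{x\in\mathbb{F}_q:(a+b^2)x^2+2abx+a^2=0\}|$, $|V_{7,a,b}^{(1)}(\mathbb{F}_q)|=|\{x\in\mathbb{F}_q:a^2x^3-bx-1=0\}|$, $|V_{7,a,b}^{(2)}(\mathbb{F}_q)|=|\{x\in\mathbb{F}_q:ax^3-bx^2+1=0\}|$, $|V_{7,a,b}^{(3)}(\mathbb{F}_q)|=|\{x\in\mathbb{F}_q:ax^3+b^2x^2+2abx+a^2=0\}|$, $|V_{13,a}(\mathbb{F}_q)|=|\{x\in\mathbb{F}_q:x^2+x-a=0\}|$, $|V_{14,a}(\mathbb{F}_q)|=|\{x\in\mathbb{F}_q:x^2-a=0\}|$. *)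

theory Defs
  imports "HOL-Analysis.Analysis"
begin

locale fin_dim_lie_algebra = finite_dimensional_vector_space scale Basis
  for scale :: "'k::field \<Rightarrow> 'v::ab_group_add \<Rightarrow> 'v"
    and Basis :: "'v set" +
  fixes bracket :: "'v \<Rightarrow> 'v \<Rightarrow> 'v"
  assumes bracket_add_left: "bracket (x + y) z = bracket x z + bracket y z"
    and bracket_add_right: "bracket x (y + z) = bracket x y + bracket x z"
    and bracket_scale_left: "bracket (scale c x) y = scale c (bracket x y)"
    and bracket_scale_right: "bracket x (scale c y) = scale c (bracket x y)"
    and bracket_self: "bracket x x = 0"
    and jacobi: "bracket x (bracket y z) + bracket y (bracket z x) + bracket z (bracket x y) = 0"
begin

definition lie_subalgebra :: "'v set \<Rightarrow> bool" where
  "lie_subalgebra H \<longleftrightarrow> subspace H \<and> (\<forall>x\<in>H. \<forall>y\<in>H. bracket x y \<in> H)"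

definition subalgebra_count :: "nat \<Rightarrow> nat" where
  "subalgebra_count i = card {H. lie_subalgebra H \<and> dim H + i = dim UNIV}"

end

locale finite_field_lie_algebra = fin_dim_lie_algebra scale Basis bracket
  for scale :: "'k::{field,finite} \<Rightarrow> 'v::ab_group_add \<Rightarrow> 'v"
    and Basis :: "'v set"
    and bracket :: "'v \<Rightarrow> 'v \<Rightarrow> 'v"
begin

definition subalgebra_zeta :: "complex \<Rightarrow> complex" where
  "subalgebra_zeta s =
     (\<Sum>i\<le>dim UNIV. of_nat (subalgebra_count i) * (of_nat CARD('k) powr (- s)) ^ i)"

end

abbreviation zeta :: "('k::{field,finite} ^ 'n \<Rightarrow> 'k ^ 'n \<Rightarrow> 'k ^ 'n) \<Rightarrow> complex \<Rightarrow> complex"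
  where "zeta L \<equiv> finite_field_lie_algebra.subalgebra_zeta (*s) L"

text \<open>
  The brackets live on \<open>'k ^ 4\<close>. The index \<open>4\<close> of the type \<open>4\<close> is the same element
  as \<open>0\<close>, so \<open>1, 2, 3, 4\<close> are its four distinct elements.
\<close>

abbreviation e :: "4 \<Rightarrow> 'k::field ^ 4" where
  "e i \<equiv> axis i 1"

text \<open>
  An entry \<open>(i, j, v)\<close> of the table stands for \<open>[e i, e j] = v\<close>; the result is the
  alternating bilinear extension, with all brackets not in the table equal to zero.
\<close>

definition bracket_table :: "(4 \<times> 4 \<times> ('k::field ^ 4)) list \<Rightarrow> 'k ^ 4 \<Rightarrow> 'k ^ 4 \<Rightarrow> 'k ^ 4" where
  "bracket_table T x y = (\<Sum>(i, j, v)\<leftarrow>T. (x $ i * y $ j - x $ j * y $ i) *s v)"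

definition M1 :: "'k::field ^ 4 \<Rightarrow> 'k ^ 4 \<Rightarrow> 'k ^ 4" where
  "M1 = bracket_table []"

definition M2 :: "'k::field ^ 4 \<Rightarrow> 'k ^ 4 \<Rightarrow> 'k ^ 4" where
  "M2 = bracket_table [(4, 1, e 1), (4, 2, e 2), (4, 3, e 3)]"

definition M3 :: "'k::field \<Rightarrow> 'k ^ 4 \<Rightarrow> 'k ^ 4 \<Rightarrow> 'k ^ 4" where
  "M3 a = bracket_table [(4, 1, e 1), (4, 2, e 3), (4, 3, (- a) *s e 2 + (a + 1) *s e 3)]"

definition M4 :: "'k::field ^ 4 \<Rightarrow> 'k ^ 4 \<Rightarrow> 'k ^ 4" where
  "M4 = bracket_table [(4, 2, e 3), (4, 3, e 3)]"

definition M5 :: "'k::field ^ 4 \<Rightarrow> 'k ^ 4 \<Rightarrow> 'k ^ 4" where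
  "M5 = bracket_table [(4, 2, e 3)]"

definition M6 :: "'k::field \<Rightarrow> 'k \<Rightarrow> 'k ^ 4 \<Rightarrow> 'k ^ 4 \<Rightarrow> 'k ^ 4" where
  "M6 a b = bracket_table [(4, 1, e 2), (4, 2, e 3), (4, 3, a *s e 1 + b *s e 2 + e 3)]"

definition M7 :: "'k::field \<Rightarrow> 'k \<Rightarrow> 'k ^ 4 \<Rightarrow> 'k ^ 4 \<Rightarrow> 'k ^ 4" where
  "M7 a b = bracket_table [(4, 1, e 2), (4, 2, e 3), (4, 3, a *s e 1 + b *s e 2)]"

definition M8 :: "'k::field ^ 4 \<Rightarrow> 'k ^ 4 \<Rightarrow> 'k ^ 4" where
  "M8 = bracket_table [(1, 2, e 2), (3, 4, e 4)]"

definition M9 :: "'k::field \<Rightarrow> 'k ^ 4 \<Rightarrow> 'k ^ 4 \<Rightarrow> 'k ^ 4" where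
  "M9 a = bracket_table [(4, 1, e 1 + a *s e 2), (4, 2, e 1), (3, 1, e 1), (3, 2, e 2)]"

definition M12 :: "'k::field ^ 4 \<Rightarrow> 'k ^ 4 \<Rightarrow> 'k ^ 4" where
  "M12 = bracket_table [(4, 1, e 1), (4, 2, 2 *s e 2), (4, 3, e 3), (3, 1, e 2)]"

definition M13 :: "'k::field \<Rightarrow> 'k ^ 4 \<Rightarrow> 'k ^ 4 \<Rightarrow> 'k ^ 4" where
  "M13 a = bracket_table [(4, 1, e 1 + a *s e 3), (4, 2, e 2), (4, 3, e 1), (3, 1, e 2)]"

definition M14 :: "'k::field \<Rightarrow> 'k ^ 4 \<Rightarrow> 'k ^ 4 \<Rightarrow> 'k ^ 4" where
  "M14 a = bracket_table [(4, 1, a *s e 3), (4, 3, e 1), (3, 1, e 2)]"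

lemma bracket_table_Nil [simp]: "bracket_table [] x y = 0"
  by (simp add: bracket_table_def)

lemma bracket_table_Cons [simp]:
  "bracket_table ((i, j, v) # T) x y = (x $ i * y $ j - x $ j * y $ i) *s v + bracket_table T x y"
  by (simp add: bracket_table_def)

lemma lie_algebra_bracket_table:
  fixes T :: "(4 \<times> 4 \<times> ('k::{field,finite} ^ 4)) list"
  assumes "\<And>x y z. bracket_table T x (bracket_table T y z) + bracket_table T y (bracket_table T z x)
      + bracket_table T z (bracket_table T x y) = 0"
  shows "finite_field_lie_algebra (*s) cart_basis (bracket_table T)"
proof unfold_locales
  fix x y z :: "'k ^ 4" and c
  show "bracket_table T (x + y) z = bracket_table T x z + bracket_table T y z"
    by (induction T) (auto simp: vec_eq_iff algebra_simps)
  show "bracket_table T x (y + z) = bracket_table T x y + bracket_table T x z"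
    by (induction T) (auto simp: vec_eq_iff algebra_simps)
  show "bracket_table T (c *s x) y = c *s bracket_table T x y"
    by (induction T) (auto simp: vec_eq_iff algebra_simps)
  show "bracket_table T x (c *s y) = c *s bracket_table T x y"
    by (induction T) (auto simp: vec_eq_iff algebra_simps)
  show "bracket_table T x x = 0"
    by (induction T) (auto simp: vec_eq_iff algebra_simps)
qed (fact assms)

lemma lie_algebra_M:
  fixes a b :: "'k::{field,finite}"
  shows "finite_field_lie_algebra (*s) cart_basis (M1 :: 'k ^ 4 \<Rightarrow> _)"
    and "finite_field_lie_algebra (*s) cart_basis (M2 :: 'k ^ 4 \<Rightarrow> _)"
    and "finite_field_lie_algebra (*s) cart_basis (M3 a)"
    and "finite_field_lie_algebra (*s) cart_basis (M4 :: 'k ^ 4 \<Rightarrow> _)"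
    and "finite_field_lie_algebra (*s) cart_basis (M5 :: 'k ^ 4 \<Rightarrow> _)"
    and "finite_field_lie_algebra (*s) cart_basis (M6 a b)"
    and "finite_field_lie_algebra (*s) cart_basis (M7 a b)"
    and "finite_field_lie_algebra (*s) cart_basis (M8 :: 'k ^ 4 \<Rightarrow> _)"
    and "finite_field_lie_algebra (*s) cart_basis (M9 a)"
    and "finite_field_lie_algebra (*s) cart_basis (M12 :: 'k ^ 4 \<Rightarrow> _)"
    and "finite_field_lie_algebra (*s) cart_basis (M13 a)"
    and "finite_field_lie_algebra (*s) cart_basis (M14 a)"
  unfolding M1_def M2_def M3_def M4_def M5_def M6_def M7_def M8_def M9_def M12_def M13_def M14_def
  by (rule lie_algebra_bracket_table; simp add: vec_eq_iff forall_4 axis_def; simp add: algebra_simps)+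

definition V3 :: "'k::field \<Rightarrow> nat" where
  "V3 a = card {x. a * x^2 - x - 1 = 0}"

definition V4 :: "'k::field \<Rightarrow> nat" where
  "V4 a = card {x. a * x^2 - 1 = 0}"

definition V6_1 :: "'k::field \<Rightarrow> 'k \<Rightarrow> nat" where
  "V6_1 a b = card {x. - (a^2) * x^3 + a * x^2 + b * x + 1 = 0}"

definition V6_2 :: "'k::field \<Rightarrow> 'k \<Rightarrow> nat" where
  "V6_2 a b = card {x. a * x^3 - b * x^2 + x + 1 = 0}"

definition V6_3 :: "'k::field \<Rightarrow> 'k \<Rightarrow> nat" where
  "V6_3 a b = card {x. (a + b) * x^3 + (a + b^2) * x^2 + 2 * a * b * x + a^2 = 0}"

definition V6_4 :: "'k::field \<Rightarrow> 'k \<Rightarrow> nat" where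
  "V6_4 a b = card {x. (a + b^2) * x^2 + 2 * a * b * x + a^2 = 0}"

definition V7_1 :: "'k::field \<Rightarrow> 'k \<Rightarrow> nat" where
  "V7_1 a b = card {x. a^2 * x^3 - b * x - 1 = 0}"

definition V7_2 :: "'k::field \<Rightarrow> 'k \<Rightarrow> nat" where
  "V7_2 a b = card {x. a * x^3 - b * x^2 + 1 = 0}"

definition V7_3 :: "'k::field \<Rightarrow> 'k \<Rightarrow> nat" where
  "V7_3 a b = card {x. a * x^3 + b^2 * x^2 + 2 * a * b * x + a^2 = 0}"

definition V13 :: "'k::field \<Rightarrow> nat" where
  "V13 a = card {x. x^2 + x - a = 0}"

definition V14 :: "'k::field \<Rightarrow> nat" where
  "V14 a = card {x. x^2 - a = 0}"

end

theory Submission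
  imports Defs
begin

text \<open>
  A subspace has a unique basis in reduced echelon form, so the subspaces of dimension \<open>d\<close>
  split into Schubert cells indexed by the pivot sets of size \<open>d\<close>, each parametrised by the
  free entries of the echelon matrix. Closure under the bracket only has to be tested on the echelon
  basis, so it is a polynomial condition on these entries, and each coefficient of the zeta function
  is a sum of numbers of solutions of small polynomial systems. For \<open>M6\<close> and \<open>M7\<close> these
  systems say that a line or a plane in the span of \<open>e 1, e 2, e 3\<close> is invariant under
  \<open>ad (e 4)\<close>; the cubics attached to these families all parametrise the eigenvalues of this
  map, in coordinates that differ by Moebius transformations.
\<close>

section \<open>Subspaces in echelon form\<close>

text \<open>Let V be the span of \<open>e 1\<close>, \<open>e 2\<close>, \<open>e 3\<close>. As
  coordinate 4 comes first, pivot sets without 4 give the subspaces of V, and pivot sets with 4 give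
  the spaces spanned by some \<open>e 4 + v\<close> and a subspace W of V. If V is an abelian ideal,
  as in \<open>M1\<close> to \<open>M7\<close>, the former are all closed, and the latter are closed
  iff W is invariant under \<open>ad (e 4)\<close>, with v free modulo W: an invariant plane
  contributes \<open>CARD('k)\<close> subalgebras of codimension 1, an eigenline
  \<open>CARD('k)^2\<close> of codimension 2, and V provides the terms 1 and 1 + q + q^2. The stated
  coefficient of t^2 for \<open>M6\<close> and \<open>M7\<close> has another shape, (q^2 - 1) times
  one point count plus a second one. Direct counting yields q^2 times the second, so equalities of
  counts are needed. For a \<noteq> 0 and an eigenvalue \<lambda>, the root in \<open>V6_1\<close>
  or \<open>V7_1\<close> is \<lambda> / a, in \<open>V6_2\<close> or \<open>V7_2\<close> it is -1 /
  \<lambda>, in \<open>V6_3\<close> or \<open>V7_3\<close> it is -a \<lambda> / (b \<lambda> + a).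
  The last one has a pole at \<lambda> = 1 for \<open>M6\<close> with b = -a, whence
  \<open>V6_4\<close>.\<close>

definition echelon_coeffs :: "'n::{finite,linorder} set \<Rightarrow> ('n \<Rightarrow> 'n \<Rightarrow> 'k::field) set" where
  "echelon_coeffs S = {c. \<forall>i j. c i j \<noteq> 0 \<longrightarrow> i \<in> S \<and> j \<notin> S \<and> i < j}"

definition echelon_row :: "('n::{finite,linorder} \<Rightarrow> 'n \<Rightarrow> 'k::field) \<Rightarrow> 'n \<Rightarrow> 'k ^ 'n::{finite,linorder}" where
  "echelon_row c i = (\<chi> j. if j = i then 1 else c i j)"

text \<open>The row space, given by equations instead of as a span: membership of a bracket then
  unfolds directly into polynomial equations in the entries of \<open>c\<close>.\<close>

definition echelon_space :: "'n::{finite,linorder} set \<Rightarrow> ('n \<Rightarrow> 'n \<Rightarrow> 'k::field) \<Rightarrow> ('k ^ 'n::{finite,linorder}) set" where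
  "echelon_space S c = {x. \<forall>j. j \<notin> S \<longrightarrow> x $ j = (\<Sum>i\<in>S. x $ i * c i j)}"

lemma echelon_coeffs_eq_0:
  assumes "c \<in> echelon_coeffs S" "\<not> (i \<in> S \<and> j \<notin> S \<and> i < j)"
  shows "c i j = 0"
  using assms by (auto simp: echelon_coeffs_def)

lemma echelon_row_pivot:
  assumes "c \<in> echelon_coeffs S" "j \<in> S"
  shows "echelon_row c i $ j = (if j = i then 1 else 0)"
  using echelon_coeffs_eq_0[OF assms(1)] assms(2) by (auto simp: echelon_row_def)

lemma subspace_echelon_space: "vec.subspace (echelon_space S c)"
  unfolding vec.subspace_def echelon_space_def
  by (auto simp: sum.distrib ring_distribs sum_distrib_left mult.assoc)

lemma echelon_row_in_space:
  assumes "c \<in> echelon_coeffs S" "i \<in> S"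
  shows "echelon_row c i \<in> echelon_space S c"
  using assms unfolding echelon_space_def
  by (auto simp: echelon_row_pivot if_distrib[where f="\<lambda>x. x * _"] sum.delta cong: if_cong)
    (auto simp: echelon_row_def)

lemma echelon_space_expand:
  assumes c: "c \<in> echelon_coeffs S" and x: "x \<in> echelon_space S c"
  shows "x = (\<Sum>i\<in>S. x $ i *s echelon_row c i)"
proof (rule vec_eq_iff[THEN iffD2], rule allI)
  fix j
  show "x $ j = (\<Sum>i\<in>S. x $ i *s echelon_row c i) $ j"
  proof (cases "j \<in> S")
    case True
    then show ?thesis
      by (simp add: echelon_row_pivot[OF c] if_distrib[where f="\<lambda>x. _ * x"] sum.delta cong: if_cong)
  next
    case False
    have "(\<Sum>i\<in>S. x $ i * c i j) = (\<Sum>i\<in>S. x $ i * echelon_row c i $ j)"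
      using False by (intro sum.cong) (auto simp: echelon_row_def)
    then show ?thesis
      using x False by (simp add: echelon_space_def)
  qed
qed

lemma dim_echelon_space:
  assumes c: "c \<in> echelon_coeffs S"
  shows "vec.dim (echelon_space S c) = card S"
proof (rule vec.dim_unique)
  have inj: "inj_on (echelon_row c) S"
    by (rule inj_onI) (metis c echelon_row_pivot zero_neq_one)
  show "echelon_row c ` S \<subseteq> echelon_space S c"
    using echelon_row_in_space[OF c] by auto
  show "echelon_space S c \<subseteq> vec.span (echelon_row c ` S)"
  proof
    fix x assume x: "x \<in> echelon_space S c"
    show "x \<in> vec.span (echelon_row c ` S)"
      by (subst echelon_space_expand[OF c x])
        (intro vec.span_sum vec.span_scale vec.span_base imageI)
  qed
  show "vec.independent (echelon_row c ` S)"
  proof (rule vec.independent_if_scalars_zero)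
    fix f v
    assume 0: "(\<Sum>v\<in>echelon_row c ` S. f v *s v) = 0" and v: "v \<in> echelon_row c ` S"
    from v obtain j where j: "j \<in> S" "v = echelon_row c j" by auto
    have "(\<Sum>i\<in>S. f (echelon_row c i) *s echelon_row c i) $ j = 0"
      using 0 by (simp add: sum.reindex[OF inj])
    then show "f v = 0"
      using j by (simp add: echelon_row_pivot[OF c] if_distrib[where f="\<lambda>x. _ * x"] sum.delta cong: if_cong)
  qed simp
  show "card (echelon_row c ` S) = card S"
    by (rule card_image[OF inj])
qed

text \<open>Pivots are the positions of leading nonzero entries of vectors of the space. This
  description does not mention \<open>c\<close>, so the space determines its pivot set.\<close>

lemma echelon_pivot_iff:
  assumes c: "c \<in> echelon_coeffs S"
  shows "i \<in> S \<longleftrightarrow> (\<exists>x\<in>echelon_space S c. x $ i \<noteq> 0 \<and> (\<forall>j<i. x $ j = 0))"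
proof
  assume i: "i \<in> S"
  moreover have "c i j = 0" if "j < i" for j
    using that by (intro echelon_coeffs_eq_0[OF c]) auto
  ultimately show "\<exists>x\<in>echelon_space S c. x $ i \<noteq> 0 \<and> (\<forall>j<i. x $ j = 0)"
    by (intro bexI[of _ "echelon_row c i"] echelon_row_in_space[OF c]) (auto simp: echelon_row_def)
next
  assume "\<exists>x\<in>echelon_space S c. x $ i \<noteq> 0 \<and> (\<forall>j<i. x $ j = 0)"
  then obtain x where x: "x \<in> echelon_space S c" "x $ i \<noteq> 0" "\<And>j. j < i \<Longrightarrow> x $ j = 0"
    by auto
  show "i \<in> S"
  proof (rule ccontr)
    assume "i \<notin> S"
    then have "x $ i = (\<Sum>m\<in>S. x $ m * c m i)"
      using x(1) by (simp add: echelon_space_def)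
    also have "\<dots> = 0"
      using x(3) echelon_coeffs_eq_0[OF c] by (intro sum.neutral) (metis mult_eq_0_iff)
    finally show False using x(2) by simp
  qed
qed

lemma echelon_space_inject:
  assumes c: "c \<in> echelon_coeffs S" and c': "c' \<in> echelon_coeffs S'"
    and eq: "echelon_space S c = echelon_space S' c'"
  shows "S = S' \<and> c = c'"
proof
  show S: "S = S'"
    using echelon_pivot_iff[OF c] echelon_pivot_iff[OF c'] unfolding eq by blast
  show "c = c'"
  proof (intro ext)
    fix i j
    show "c i j = c' i j"
    proof (cases "i \<in> S \<and> j \<notin> S")
      case True
      \<comment> \<open>Among the pivot coordinates this row is nonzero only at \<open>i\<close>, so
        its defining equation at a non-pivot \<open>j\<close> reads off
        \<open>c i j\<close>.\<close>
      then have "echelon_row c' i \<in> echelon_space S c"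
        using echelon_row_in_space[OF c'] S eq by simp
      then have "echelon_row c' i $ j = (\<Sum>m\<in>S. echelon_row c' i $ m * c m j)"
        using True by (simp add: echelon_space_def)
      also have "\<dots> = (\<Sum>m\<in>S. if m = i then c m j else 0)"
        using c' S by (intro sum.cong) (auto simp: echelon_row_pivot)
      finally show ?thesis
        using True by (auto simp: echelon_row_def split: if_splits)
    qed (use echelon_coeffs_eq_0[OF c] echelon_coeffs_eq_0[OF c'] S in auto)
  qed
qed

lemma echelon_space_exists:
  fixes H :: "('k::field ^ 'n::{finite,linorder}) set"
  assumes H: "vec.subspace H"
  shows "\<exists>S. \<exists>c\<in>echelon_coeffs S. H = echelon_space S c"
proof -
  define S where "S = {i. \<exists>x\<in>H. x $ i \<noteq> 0 \<and> (\<forall>j<i. x $ j = 0)}"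
  \<comment> \<open>The leading position of a nonzero vector of \<open>H\<close> belongs to
    \<open>S\<close>, so vectors of \<open>H\<close> are determined by their coordinates in
    \<open>S\<close>.\<close>
  have vanish: "x = 0" if "x \<in> H" "\<forall>i\<in>S. x $ i = 0" for x
  proof (rule ccontr)
    assume "x \<noteq> 0"
    then have ne: "{i. x $ i \<noteq> 0} \<noteq> {}" by (auto simp: vec_eq_iff)
    define m where "m = Min {i. x $ i \<noteq> 0}"
    have "x $ m \<noteq> 0" using Min_in[OF _ ne] by (simp add: m_def)
    moreover have "m \<le> j" if "x $ j \<noteq> 0" for j
      unfolding m_def using that by (intro Min_le) auto
    then have "\<forall>j<m. x $ j = 0"
      by (auto simp: not_less[symmetric])
    ultimately have "m \<in> S" using that(1) by (auto simp: S_def)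
    then show False using that(2) \<open>x $ m \<noteq> 0\<close> by auto
  qed
  \<comment> \<open>Back substitution: the induction treats later pivots first, so their fully
    reduced rows are available to clear the entries of a row with leading position
    \<open>i\<close>.\<close>
  have reduced: "\<exists>b\<in>H. b $ i = 1 \<and> (\<forall>j<i. b $ j = 0) \<and> (\<forall>j\<in>S - {i}. b $ j = 0)" if "i \<in> S" for i
    using that
  proof (induction "card {j. j > i}" arbitrary: i rule: less_induct)
    case less
    obtain y where y: "y \<in> H" "y $ i \<noteq> 0" "\<And>j. j < i \<Longrightarrow> y $ j = 0"
      using less.prems by (auto simp: S_def)
    define x where "x = inverse (y $ i) *s y"
    have x: "x \<in> H" "x $ i = 1" "\<And>j. j < i \<Longrightarrow> x $ j = 0"
      using y H by (auto simp: x_def vec.subspace_scale)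
    have "\<exists>b. b \<in> H \<and> b $ j = 1 \<and> (\<forall>m<j. b $ m = 0) \<and> (\<forall>m\<in>S - {j}. b $ m = 0)"
      if "j \<in> S" "i < j" for j
    proof -
      have "card {m. m > j} < card {m. m > i}"
        using that by (intro psubset_card_mono) auto
      then show ?thesis using less.hyps[of j] that by auto
    qed
    then obtain b where b: "\<And>j. \<lbrakk>j \<in> S; i < j\<rbrakk> \<Longrightarrow>
        b j \<in> H \<and> b j $ j = 1 \<and> (\<forall>m<j. b j $ m = 0) \<and> (\<forall>m\<in>S - {j}. b j $ m = 0)"
      by metis
    define T where "T = {j\<in>S. i < j}"
    \<comment> \<open>Each subtracted row is 1 at its own pivot and 0 at all other pivots, so the
      entries at later pivots are cleared independently. These rows vanish up to position
      \<open>i\<close>, so the leading 1 survives.\<close>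
    define z where "z = x - (\<Sum>j\<in>T. x $ j *s b j)"
    have "z \<in> H"
      unfolding z_def using x(1) b H
      by (intro vec.subspace_diff vec.subspace_sum vec.subspace_scale) (auto simp: T_def)
    moreover have low: "(\<Sum>j\<in>T. x $ j * b j $ m) = 0" if "m \<le> i" for m
      using b that by (intro sum.neutral) (auto simp: T_def)
    then have "z $ i = 1" "\<forall>j<i. z $ j = 0"
      using x by (auto simp: z_def)
    moreover have "z $ m = 0" if "m \<in> S - {i}" for m
    proof (cases "m < i")
      case True
      then show ?thesis using \<open>\<forall>j<i. z $ j = 0\<close> by blast
    next
      case False
      with that have m: "m \<in> T" by (auto simp: T_def)
      have "(\<Sum>j\<in>T. x $ j * b j $ m) = (\<Sum>j\<in>T. if j = m then x $ j else 0)"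
        using b m by (intro sum.cong) (auto simp: T_def)
      then show ?thesis using m by (simp add: z_def)
    qed
    ultimately show ?case by blast
  qed
  then obtain b where b: "\<And>i. i \<in> S \<Longrightarrow>
      b i \<in> H \<and> b i $ i = 1 \<and> (\<forall>j<i. b i $ j = 0) \<and> (\<forall>j\<in>S - {i}. b i $ j = 0)"
    by metis
  define c where "c i j = (if i \<in> S \<and> j \<notin> S then b i $ j else 0)" for i j
  have c: "c \<in> echelon_coeffs S"
    unfolding echelon_coeffs_def c_def using b by (auto split: if_splits) (metis linorder_less_linear)
  have row: "echelon_row c i = b i" if "i \<in> S" for i
    using that b by (auto simp: vec_eq_iff echelon_row_def c_def)
  have "echelon_space S c \<subseteq> H"
  proof
    fix x assume x: "x \<in> echelon_space S c"
    show "x \<in> H"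
      by (subst echelon_space_expand[OF c x])
        (use b row H in \<open>auto intro!: vec.subspace_sum vec.subspace_scale\<close>)
  qed
  moreover have "H \<subseteq> echelon_space S c"
  proof
    fix x assume x: "x \<in> H"
    \<comment> \<open>The only candidate for \<open>x\<close>: the combination of rows with the same
      pivot coordinates. The difference lies in \<open>H\<close> and vanishes on
      \<open>S\<close>.\<close>
    define y where "y = (\<Sum>i\<in>S. x $ i *s echelon_row c i)"
    have y: "y \<in> echelon_space S c"
      unfolding y_def using echelon_row_in_space[OF c]
      by (intro vec.subspace_sum vec.subspace_scale subspace_echelon_space)
    have "x - y \<in> H"
      using x y \<open>echelon_space S c \<subseteq> H\<close> H by (auto intro: vec.subspace_diff)
    moreover have "\<forall>i\<in>S. (x - y) $ i = 0"
      by (simp add: y_def echelon_row_pivot[OF c] if_distrib[where f="\<lambda>x. _ * x"] sum.delta cong: if_cong)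
    ultimately have "x - y = 0" by (rule vanish)
    then show "x \<in> echelon_space S c" using y by simp
  qed
  ultimately show ?thesis using c by blast
qed

lemma card_subspaces_echelon:
  fixes P :: "('k::{field,finite} ^ 'n::{finite,linorder}) set \<Rightarrow> bool"
  shows "card {H. vec.subspace H \<and> vec.dim H = d \<and> P H} =
    (\<Sum>S | card S = d. card {c \<in> echelon_coeffs S. P (echelon_space S c)})"
proof -
  let ?A = "SIGMA S:{S. card S = d}. {c \<in> echelon_coeffs S. P (echelon_space S c)}"
  have "bij_betw (\<lambda>(S, c). echelon_space S c) ?A {H. vec.subspace H \<and> vec.dim H = d \<and> P H}"
  proof (rule bij_betw_imageI)
    show "inj_on (\<lambda>(S, c). echelon_space S c) ?A"
      by (auto simp: inj_on_def dest: echelon_space_inject)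
    show "(\<lambda>(S, c). echelon_space S c) ` ?A = {H. vec.subspace H \<and> vec.dim H = d \<and> P H}"
    proof (intro equalityI subsetI)
      fix H assume "H \<in> {H. vec.subspace H \<and> vec.dim H = d \<and> P H}"
      moreover then obtain S c where "c \<in> echelon_coeffs S" "H = echelon_space S c"
        using echelon_space_exists by blast
      ultimately show "H \<in> (\<lambda>(S, c). echelon_space S c) ` ?A"
        by (auto simp: dim_echelon_space intro!: image_eqI[of _ _ "(S, c)"])
    qed (auto simp: dim_echelon_space subspace_echelon_space)
  qed
  then show ?thesis
    by (simp add: bij_betw_same_card[symmetric] card_SigmaI)
qed

text \<open>
  Since \<open>4 = 0\<close> in the type \<open>4\<close>, the pivots are ordered \<open>4, 1, 2, 3\<close>.
\<close>

lemma less_4: "(4::4) < 1" "(4::4) < 2" "(4::4) < 3" "(1::4) < 2" "(1::4) < 3" "(2::4) < 3"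
  by (simp_all add: less_bit0_def bit0.Rep_numeral bit0.Rep_1)

lemma singles_4: "{S::4 set. card S = 1} = {{4},{1},{2},{3}}" (is "?L = ?R")
proof
  show "?L \<subseteq> ?R"
  proof
    fix S :: "4 set" assume "S \<in> ?L"
    then obtain x where "S = {x}" by (auto simp: card_1_singleton_iff)
    then show "S \<in> ?R"
      using exhaust_4[of x] by (elim disjE) simp_all
  qed
qed auto

lemma pairs_4: "{S::4 set. card S = 2} = {{4,1},{4,2},{4,3},{1,2},{1,3},{2,3}}" (is "?L = ?R")
proof
  show "?L \<subseteq> ?R"
  proof
    fix S :: "4 set" assume "S \<in> ?L"
    then obtain x y where "S = {x, y}" "x \<noteq> y" by (auto simp: card_2_iff)
    then show "S \<in> ?R"
      using exhaust_4[of x] exhaust_4[of y] by (elim disjE) (simp_all add: insert_commute)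
  qed
qed auto

lemma triples_4: "{S::4 set. card S = 3} = {{4,1,2},{4,1,3},{4,2,3},{1,2,3}}" (is "?L = ?R")
proof
  show "?L \<subseteq> ?R"
  proof
    fix S :: "4 set" assume "S \<in> ?L"
    then obtain x y z where "S = {x, y, z}" "x \<noteq> y" "x \<noteq> z" "y \<noteq> z" by (auto simp: card_3_iff)
    then show "S \<in> ?R"
      using exhaust_4[of x] exhaust_4[of y] exhaust_4[of z] by (elim disjE) (simp_all add: insert_commute)
  qed
qed auto

section \<open>Subalgebras of four-dimensional Lie algebras\<close>

text \<open>Closure is split off from being a subspace because the cell decomposition accounts for
  the subspaces and only this predicate has to be tested on each cell.\<close>

definition bracket_closed :: "('v \<Rightarrow> 'v \<Rightarrow> 'v) \<Rightarrow> 'v set \<Rightarrow> bool" where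
  "bracket_closed L H \<longleftrightarrow> (\<forall>x\<in>H. \<forall>y\<in>H. L x y \<in> H)"

text \<open>By bilinearity closure is inherited from the rows, one argument at a time. Ordered pairs
  of rows suffice because an alternating bracket vanishes on the diagonal and is
  antisymmetric.\<close>

lemma bracket_closed_echelon:
  fixes L :: "('k::{field,finite}, 'n::{finite,linorder}) vec \<Rightarrow> ('k, 'n) vec \<Rightarrow> ('k, 'n) vec"
  assumes "finite_field_lie_algebra (*s) cart_basis L" and c: "c \<in> echelon_coeffs S"
  shows "bracket_closed L (echelon_space S c) \<longleftrightarrow>
    (\<forall>i\<in>S. \<forall>j\<in>S. i < j \<longrightarrow> L (echelon_row c i) (echelon_row c j) \<in> echelon_space S c)"
    (is "_ \<longleftrightarrow> ?R")
proof
  assume "bracket_closed L (echelon_space S c)"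
  then show ?R
    using echelon_row_in_space[OF c] by (auto simp: bracket_closed_def)
next
  assume R: ?R
  interpret finite_field_lie_algebra "(*s)" cart_basis L by fact
  let ?H = "echelon_space S c" and ?b = "echelon_row c"
  note sub = subspace_echelon_space[of S c]
  have zero: "L 0 y = 0" "L x 0 = 0" for x y
    using bracket_scale_left[of 0 0 y] bracket_scale_right[of x 0 0] by simp_all
  have left: "vec.subspace {x. L x y \<in> ?H}" and right: "vec.subspace {x. L y x \<in> ?H}" for y
    using sub unfolding vec.subspace_def
    by (auto simp: bracket_add_left bracket_add_right bracket_scale_left bracket_scale_right zero)
  have swap: "L y x = - L x y" for x y
  proof -
    have "L (x + y) (x + y) = L y x + L x y"
      unfolding bracket_add_left bracket_add_right by (simp add: bracket_self)
    then show ?thesis by (simp add: bracket_self eq_neg_iff_add_eq_0)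
  qed
  have basis: "L (?b i) (?b j) \<in> ?H" if "i \<in> S" "j \<in> S" for i j
  proof (cases i j rule: linorder_cases)
    case greater
    then have "L (?b j) (?b i) \<in> ?H" using R that by blast
    then show ?thesis unfolding swap[of "?b i"] by (rule vec.subspace_neg[OF sub])
  qed (use R that sub in \<open>auto simp: bracket_self vec.subspace_0\<close>)
  have "?H \<subseteq> {x. L x (?b j) \<in> ?H}" if "j \<in> S" for j
  proof
    fix x assume x: "x \<in> ?H"
    show "x \<in> {x. L x (?b j) \<in> ?H}"
      by (subst echelon_space_expand[OF c x])
        (intro vec.subspace_sum[OF left] vec.subspace_scale[OF left] CollectI basis that)
  qed
  then have row: "L x (?b j) \<in> ?H" if "x \<in> ?H" "j \<in> S" for x j
    using that by auto
  have "L x y \<in> ?H" if x: "x \<in> ?H" and y: "y \<in> ?H" for x y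
  proof -
    have "y \<in> {y. L x y \<in> ?H}"
      by (subst echelon_space_expand[OF c y])
        (intro vec.subspace_sum[OF right] vec.subspace_scale[OF right] CollectI row x)
    then show ?thesis by simp
  qed
  then show "bracket_closed L ?H" by (auto simp: bracket_closed_def)
qed

section \<open>The Schubert cells of a four-dimensional space in coordinates\<close>

lemma sum_singles_4: "sum f {S::4 set. card S = 1} = f {4} + f {1} + f {2} + f {3}"
  for f :: "4 set \<Rightarrow> nat"
  unfolding singles_4 by simp

lemma sum_pairs_4:
  "sum f {S::4 set. card S = 2} = f {4,1} + f {4,2} + f {4,3} + f {1,2} + f {1,3} + f {2,3}"
  for f :: "4 set \<Rightarrow> nat"
  unfolding pairs_4 by (simp add: doubleton_eq_iff)

lemma sum_triples_4:
  "sum f {S::4 set. card S = 3} = f {4,1,2} + f {4,1,3} + f {4,2,3} + f {1,2,3}"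
  for f :: "4 set \<Rightarrow> nat"
  unfolding triples_4 by (simp add: set_eq_iff forall_4)

text \<open>An echelon matrix as a finite list of its free entries, so that rewriting evaluates each
  entry at numeral positions.\<close>

definition coeff_table :: "(4 \<times> 4 \<times> 'k::field) list \<Rightarrow> 4 \<Rightarrow> 4 \<Rightarrow> 'k" where
  "coeff_table T i j = (\<Sum>(k, l, v)\<leftarrow>T. if i = k \<and> j = l then v else 0)"

lemma coeff_table_simps [simp]:
  "coeff_table [] i j = 0"
  "coeff_table ((k, l, v) # T) i j = (if i = k \<and> j = l then v else 0) + coeff_table T i j"
  by (simp_all add: coeff_table_def)

lemma not_less_4: "\<not> (1::4) < 4" "\<not> (2::4) < 4" "\<not> (3::4) < 4" "\<not> (2::4) < 1" "\<not> (3::4) < 1" "\<not> (3::4) < 2"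
  using less_4 by (simp_all add: not_less)

lemma card_Collect_by_witness:
  assumes "\<And>x. f x \<in> A" "\<And>x. g (f x) = x" "\<And>c. c \<in> A \<Longrightarrow> f (g c) = c"
  shows "card {c \<in> A. P c} = card {x. P (f x)}"
  by (rule bij_betw_same_card[of g], rule bij_betw_byWitness[where f' = f]) (use assms in auto)

text \<open>The free entries sit at pairs of a pivot and a later non-pivot in the order 4, 1, 2, 3.
  A cell whose pivots come last has none and is a single point, hence the
  \<open>of_bool\<close>.\<close>

lemma card_echelon_coeffs_4:
  fixes P :: "(4 \<Rightarrow> 4 \<Rightarrow> 'k::{field,finite}) \<Rightarrow> bool"
  shows
  "card {c \<in> echelon_coeffs {4}. P c} =
    card {(p, q, r). P (coeff_table [(4, 1, p), (4, 2, q), (4, 3, r)])}"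
    and "card {c \<in> echelon_coeffs {1}. P c} =
    card {(p, q). P (coeff_table [(1, 2, p), (1, 3, q)])}"
    and "card {c \<in> echelon_coeffs {2}. P c} =
    card {p. P (coeff_table [(2, 3, p)])}"
    and "card {c \<in> echelon_coeffs {3}. P c} = of_bool (P (coeff_table []))"
    and "card {c \<in> echelon_coeffs {4, 1}. P c} =
    card {(p, q, r, s). P (coeff_table [(4, 2, p), (4, 3, q), (1, 2, r), (1, 3, s)])}"
    and "card {c \<in> echelon_coeffs {4, 2}. P c} =
    card {(p, q, r). P (coeff_table [(4, 1, p), (4, 3, q), (2, 3, r)])}"
    and "card {c \<in> echelon_coeffs {4, 3}. P c} =
    card {(p, q). P (coeff_table [(4, 1, p), (4, 2, q)])}"
    and "card {c \<in> echelon_coeffs {1, 2}. P c} =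
    card {(p, q). P (coeff_table [(1, 3, p), (2, 3, q)])}"
    and "card {c \<in> echelon_coeffs {1, 3}. P c} =
    card {p. P (coeff_table [(1, 2, p)])}"
    and "card {c \<in> echelon_coeffs {2, 3}. P c} = of_bool (P (coeff_table []))"
    and "card {c \<in> echelon_coeffs {4, 1, 2}. P c} =
    card {(p, q, r). P (coeff_table [(4, 3, p), (1, 3, q), (2, 3, r)])}"
    and "card {c \<in> echelon_coeffs {4, 1, 3}. P c} =
    card {(p, q). P (coeff_table [(4, 2, p), (1, 2, q)])}"
    and "card {c \<in> echelon_coeffs {4, 2, 3}. P c} =
    card {p. P (coeff_table [(4, 1, p)])}"
    and "card {c \<in> echelon_coeffs {1, 2, 3}. P c} = of_bool (P (coeff_table []))"
proof -
  show "card {c \<in> echelon_coeffs {4}. P c} =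
    card {(p, q, r). P (coeff_table [(4, 1, p), (4, 2, q), (4, 3, r)])}"
    by (subst card_Collect_by_witness[where f = "\<lambda>(p, q, r). coeff_table [(4, 1, p), (4, 2, q), (4, 3, r)]" and g = "\<lambda>c. (c 4 1, c 4 2, c 4 3)"])
      (auto simp: echelon_coeffs_def fun_eq_iff forall_4 less_4 not_less_4 case_prod_unfold)
  show "card {c \<in> echelon_coeffs {1}. P c} =
    card {(p, q). P (coeff_table [(1, 2, p), (1, 3, q)])}"
    by (subst card_Collect_by_witness[where f = "\<lambda>(p, q). coeff_table [(1, 2, p), (1, 3, q)]" and g = "\<lambda>c. (c 1 2, c 1 3)"])
      (auto simp: echelon_coeffs_def fun_eq_iff forall_4 less_4 not_less_4 case_prod_unfold)
  show "card {c \<in> echelon_coeffs {2}. P c} =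
    card {p. P (coeff_table [(2, 3, p)])}"
    by (subst card_Collect_by_witness[where f = "\<lambda>p. coeff_table [(2, 3, p)]" and g = "\<lambda>c. (c 2 3)"])
      (auto simp: echelon_coeffs_def fun_eq_iff forall_4 less_4 not_less_4 case_prod_unfold)
  have "echelon_coeffs {3} = {coeff_table [] :: 4 \<Rightarrow> 4 \<Rightarrow> 'k}"
    by (auto simp: echelon_coeffs_def fun_eq_iff forall_4 less_4 not_less_4)
  then have "{c \<in> echelon_coeffs {3}. P c} =
      (if P (coeff_table []) then {coeff_table []} else {})"
    by auto
  then show "card {c \<in> echelon_coeffs {3}. P c} = of_bool (P (coeff_table []))"
    by simp
  show "card {c \<in> echelon_coeffs {4, 1}. P c} =
    card {(p, q, r, s). P (coeff_table [(4, 2, p), (4, 3, q), (1, 2, r), (1, 3, s)])}"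
    by (subst card_Collect_by_witness[where f = "\<lambda>(p, q, r, s). coeff_table [(4, 2, p), (4, 3, q), (1, 2, r), (1, 3, s)]" and g = "\<lambda>c. (c 4 2, c 4 3, c 1 2, c 1 3)"])
      (auto simp: echelon_coeffs_def fun_eq_iff forall_4 less_4 not_less_4 case_prod_unfold)
  show "card {c \<in> echelon_coeffs {4, 2}. P c} =
    card {(p, q, r). P (coeff_table [(4, 1, p), (4, 3, q), (2, 3, r)])}"
    by (subst card_Collect_by_witness[where f = "\<lambda>(p, q, r). coeff_table [(4, 1, p), (4, 3, q), (2, 3, r)]" and g = "\<lambda>c. (c 4 1, c 4 3, c 2 3)"])
      (auto simp: echelon_coeffs_def fun_eq_iff forall_4 less_4 not_less_4 case_prod_unfold)
  show "card {c \<in> echelon_coeffs {4, 3}. P c} =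
    card {(p, q). P (coeff_table [(4, 1, p), (4, 2, q)])}"
    by (subst card_Collect_by_witness[where f = "\<lambda>(p, q). coeff_table [(4, 1, p), (4, 2, q)]" and g = "\<lambda>c. (c 4 1, c 4 2)"])
      (auto simp: echelon_coeffs_def fun_eq_iff forall_4 less_4 not_less_4 case_prod_unfold)
  show "card {c \<in> echelon_coeffs {1, 2}. P c} =
    card {(p, q). P (coeff_table [(1, 3, p), (2, 3, q)])}"
    by (subst card_Collect_by_witness[where f = "\<lambda>(p, q). coeff_table [(1, 3, p), (2, 3, q)]" and g = "\<lambda>c. (c 1 3, c 2 3)"])
      (auto simp: echelon_coeffs_def fun_eq_iff forall_4 less_4 not_less_4 case_prod_unfold)
  show "card {c \<in> echelon_coeffs {1, 3}. P c} =
    card {p. P (coeff_table [(1, 2, p)])}"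
    by (subst card_Collect_by_witness[where f = "\<lambda>p. coeff_table [(1, 2, p)]" and g = "\<lambda>c. (c 1 2)"])
      (auto simp: echelon_coeffs_def fun_eq_iff forall_4 less_4 not_less_4 case_prod_unfold)
  have "echelon_coeffs {2, 3} = {coeff_table [] :: 4 \<Rightarrow> 4 \<Rightarrow> 'k}"
    by (auto simp: echelon_coeffs_def fun_eq_iff forall_4 less_4 not_less_4)
  then have "{c \<in> echelon_coeffs {2, 3}. P c} =
      (if P (coeff_table []) then {coeff_table []} else {})"
    by auto
  then show "card {c \<in> echelon_coeffs {2, 3}. P c} = of_bool (P (coeff_table []))"
    by simp
  show "card {c \<in> echelon_coeffs {4, 1, 2}. P c} =
    card {(p, q, r). P (coeff_table [(4, 3, p), (1, 3, q), (2, 3, r)])}"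
    by (subst card_Collect_by_witness[where f = "\<lambda>(p, q, r). coeff_table [(4, 3, p), (1, 3, q), (2, 3, r)]" and g = "\<lambda>c. (c 4 3, c 1 3, c 2 3)"])
      (auto simp: echelon_coeffs_def fun_eq_iff forall_4 less_4 not_less_4 case_prod_unfold)
  show "card {c \<in> echelon_coeffs {4, 1, 3}. P c} =
    card {(p, q). P (coeff_table [(4, 2, p), (1, 2, q)])}"
    by (subst card_Collect_by_witness[where f = "\<lambda>(p, q). coeff_table [(4, 2, p), (1, 2, q)]" and g = "\<lambda>c. (c 4 2, c 1 2)"])
      (auto simp: echelon_coeffs_def fun_eq_iff forall_4 less_4 not_less_4 case_prod_unfold)
  show "card {c \<in> echelon_coeffs {4, 2, 3}. P c} =
    card {p. P (coeff_table [(4, 1, p)])}"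
    by (subst card_Collect_by_witness[where f = "\<lambda>p. coeff_table [(4, 1, p)]" and g = "\<lambda>c. (c 4 1)"])
      (auto simp: echelon_coeffs_def fun_eq_iff forall_4 less_4 not_less_4 case_prod_unfold)
  have "echelon_coeffs {1, 2, 3} = {coeff_table [] :: 4 \<Rightarrow> 4 \<Rightarrow> 'k}"
    by (auto simp: echelon_coeffs_def fun_eq_iff forall_4 less_4 not_less_4)
  then have "{c \<in> echelon_coeffs {1, 2, 3}. P c} =
      (if P (coeff_table []) then {coeff_table []} else {})"
    by auto
  then show "card {c \<in> echelon_coeffs {1, 2, 3}. P c} = of_bool (P (coeff_table []))"
    by simp
qed

section \<open>Coefficients of the zeta function of an arbitrary four-dimensional Lie
  algebra\<close>

context
  fixes L :: "'k::{field,finite} ^ 4 \<Rightarrow> 'k ^ 4 \<Rightarrow> 'k ^ 4"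
  assumes lie: "finite_field_lie_algebra (*s) cart_basis L"
begin

interpretation finite_field_lie_algebra "(*s)" cart_basis L
  by (rule lie)

lemma subalgebra_count_echelon:
  assumes "d + i = 4"
  shows "subalgebra_count i =
    (\<Sum>S | card S = d. card {c \<in> echelon_coeffs S. \<forall>i\<in>S. \<forall>j\<in>S. i < j \<longrightarrow>
      L (echelon_row c i) (echelon_row c j) \<in> echelon_space S c})"
proof -
  have "vec.dim H + i = vec.dim (UNIV :: ('k ^ 4) set) \<longleftrightarrow> vec.dim H = d" for H :: "('k ^ 4) set"
    unfolding vec_dim_card using assms by auto
  then have "subalgebra_count i = card {H. vec.subspace H \<and> vec.dim H = d \<and> bracket_closed L H}"
    unfolding subalgebra_count_def lie_subalgebra_def bracket_closed_def
    by (intro arg_cong[where f=card]) auto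
  also have "\<dots> = (\<Sum>S | card S = d. card {c \<in> echelon_coeffs S. bracket_closed L (echelon_space S c)})"
    by (rule card_subspaces_echelon)
  finally show ?thesis
    by (simp add: bracket_closed_echelon[OF lie] cong: conj_cong)
qed

lemma subalgebra_count_0: "subalgebra_count 0 = 1"
proof -
  have "echelon_coeffs (UNIV :: 4 set) = {\<lambda>_ _. 0 :: 'k}"
    by (auto simp: echelon_coeffs_def fun_eq_iff)
  moreover have "card S = 4 \<longleftrightarrow> S = UNIV" for S :: "4 set"
    using card_eq_UNIV_imp_eq_UNIV[of S] by auto
  ultimately show ?thesis
    by (simp add: subalgebra_count_echelon[of 4] echelon_space_def)
qed

lemma subalgebra_count_4: "subalgebra_count 4 = 1"
proof -
  have "echelon_coeffs ({} :: 4 set) = {\<lambda>_ _. 0 :: 'k}"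
    by (auto simp: echelon_coeffs_def fun_eq_iff)
  then show ?thesis
    by (simp add: subalgebra_count_echelon[of 0])
qed

text \<open>Every line is a subalgebra: a single row leaves no pair to test, so this is the number
  of points of projective 3-space, cell by cell.\<close>

lemma subalgebra_count_3: "subalgebra_count 3 = 1 + CARD('k) + CARD('k)^2 + CARD('k)^3"
  by (simp add: subalgebra_count_echelon[of 1] sum_singles_4[simplified] card_echelon_coeffs_4[where P="\<lambda>_. True", simplified]
     split_beta' power2_eq_square power3_eq_cube)

text \<open>One summand per pivot pair, in the order of \<open>sum_pairs_4\<close>. The bracket
  stands on the left of a membership so that it occurs once per test and is evaluated only after
  \<open>L\<close> is instantiated.\<close>

lemma subalgebra_count_2:
  "subalgebra_count 2 =
    card {(p, q, r, s). L (e 4 + (p *s e 2 + q *s e 3)) (e 1 + (r *s e 2 + s *s e 3)) \<in>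
      {w. w $ 2 = w $ 4 * p + w $ 1 * r \<and> w $ 3 = w $ 4 * q + w $ 1 * s}} +
    card {(p, q, r). L (e 4 + (p *s e 1 + q *s e 3)) (e 2 + r *s e 3) \<in>
      {w. w $ 1 = w $ 4 * p \<and> w $ 3 = w $ 4 * q + w $ 2 * r}} +
    card {(p, q). L (e 4 + (p *s e 1 + q *s e 2)) (e 3) \<in>
      {w. w $ 1 = w $ 4 * p \<and> w $ 2 = w $ 4 * q}} +
    card {(p, q). L (e 1 + p *s e 3) (e 2 + q *s e 3) \<in>
      {w. w $ 3 = w $ 1 * p + w $ 2 * q \<and> w $ 4 = 0}} +
    card {p. L (e 1 + p *s e 2) (e 3) \<in> {w. w $ 2 = w $ 1 * p \<and> w $ 4 = 0}} +
    of_bool (L (e 2) (e 3) \<in> {w. w $ 1 = 0 \<and> w $ 4 = 0})"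
  (is "_ = ?rhs")
proof -
  have row: "echelon_row (coeff_table T) i = e i + (\<chi> j. coeff_table T i j)"
    if "coeff_table T i i = 0" for T i
    using that by (simp add: echelon_row_def vec_eq_iff axis_def)
  have rows:
    "(\<chi> j. if j = 1 then p else 0) = p *s e 1"
    "(\<chi> j. if j = 2 then p else 0) = p *s e 2"
    "(\<chi> j. if j = 3 then p else 0) = p *s e 3"
    "(\<chi> j. (if j = 2 then p else 0) + (if j = 3 then q else 0)) = p *s e 2 + q *s e 3"
    "(\<chi> j. (if j = 1 then p else 0) + (if j = 3 then q else 0)) = p *s e 1 + q *s e 3"
    "(\<chi> j. (if j = 1 then p else 0) + (if j = 2 then q else 0)) = p *s e 1 + q *s e 2"
    "(\<chi> j. 0) = 0"
    for p q :: 'k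
    by (simp_all add: vec_eq_iff axis_def)
  show ?thesis
    unfolding subalgebra_count_echelon[of 2 2, simplified] sum_pairs_4
    by (simp add: card_echelon_coeffs_4 less_4 not_less_4 row rows)
      (simp add: echelon_space_def forall_4)
qed

lemma subalgebra_count_1:
  "subalgebra_count 1 =
    card {(p, q, r).
      L (e 4 + p *s e 3) (e 1 + q *s e 3) \<in> {w. w $ 3 = w $ 4 * p + w $ 1 * q + w $ 2 * r} \<and>
      L (e 4 + p *s e 3) (e 2 + r *s e 3) \<in> {w. w $ 3 = w $ 4 * p + w $ 1 * q + w $ 2 * r} \<and>
      L (e 1 + q *s e 3) (e 2 + r *s e 3) \<in> {w. w $ 3 = w $ 4 * p + w $ 1 * q + w $ 2 * r}} +
    card {(p, q).
      L (e 4 + p *s e 2) (e 1 + q *s e 2) \<in> {w. w $ 2 = w $ 4 * p + w $ 1 * q} \<and>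
      L (e 4 + p *s e 2) (e 3) \<in> {w. w $ 2 = w $ 4 * p + w $ 1 * q} \<and>
      L (e 1 + q *s e 2) (e 3) \<in> {w. w $ 2 = w $ 4 * p + w $ 1 * q}} +
    card {p.
      L (e 4 + p *s e 1) (e 2) \<in> {w. w $ 1 = w $ 4 * p} \<and>
      L (e 4 + p *s e 1) (e 3) \<in> {w. w $ 1 = w $ 4 * p} \<and>
      L (e 2) (e 3) \<in> {w. w $ 1 = w $ 4 * p}} +
    of_bool (L (e 1) (e 2) \<in> {w. w $ 4 = 0} \<and> L (e 1) (e 3) \<in> {w. w $ 4 = 0} \<and>
      L (e 2) (e 3) \<in> {w. w $ 4 = 0})"
proof -
  have row: "echelon_row (coeff_table T) i = e i + (\<chi> j. coeff_table T i j)"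
    if "coeff_table T i i = 0" for T i
    using that by (simp add: echelon_row_def vec_eq_iff axis_def)
  have rows:
    "(\<chi> j. if j = 1 then p else 0) = p *s e 1"
    "(\<chi> j. if j = 2 then p else 0) = p *s e 2"
    "(\<chi> j. if j = 3 then p else 0) = p *s e 3"
    "(\<chi> j. 0) = 0"
    for p q :: 'k
    by (simp_all add: vec_eq_iff axis_def)
  have three_one: "3 + 1 = (4::nat)" by simp
  show ?thesis
    unfolding subalgebra_count_echelon[OF three_one] sum_triples_4
    by (simp add: card_echelon_coeffs_4 less_4 not_less_4 row rows)
      (simp add: echelon_space_def forall_4 add.assoc conj_ac)
qed

text \<open>The coefficients in codimension 0, 3 and 4 are the same for all algebras; only
  codimension 1 and 2 remain to be counted.\<close>

lemma zeta_eq: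
  fixes s :: complex
  defines "q \<equiv> of_nat CARD('k)"
  defines "t \<equiv> q powr (- s)"
  shows "zeta L s = 1 + of_nat (subalgebra_count 1) * t + of_nat (subalgebra_count 2) * t^2
    + (1 + q + q^2 + q^3) * t^3 + t^4"
proof -
  have "zeta L s = (\<Sum>i\<le>4. of_nat (subalgebra_count i) * t ^ i)"
    unfolding subalgebra_zeta_def vec_dim_card by (simp add: t_def q_def)
  also have "{..4::nat} = {0, 1, 2, 3, 4}" by auto
  finally show ?thesis
    by (simp add: subalgebra_count_0 subalgebra_count_3 subalgebra_count_4 q_def)
qed

end

abbreviation count_codim :: "('k::{field,finite} ^ 4 \<Rightarrow> 'k ^ 4 \<Rightarrow> 'k ^ 4) \<Rightarrow> nat \<Rightarrow> nat" where
  "count_codim L \<equiv> fin_dim_lie_algebra.subalgebra_count (*s) L"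

section \<open>Cardinalities of solution sets\<close>

lemma card_eq_by_witness:
  assumes "\<And>x. x \<in> S \<Longrightarrow> f x \<in> T \<and> g (f x) = x" "\<And>y. y \<in> T \<Longrightarrow> g y \<in> S \<and> f (g y) = y"
  shows "card S = card T"
  by (rule bij_betw_same_card[of f], rule bij_betw_byWitness[where f' = g]) (use assms in auto)

lemma card_Collect_snd:
  "card {(x::'a::finite, y::'b::finite). P y} = CARD('a) * card {y. P y}"
proof -
  have "{(x::'a, y). P y} = UNIV \<times> {y. P y}" by auto
  then show ?thesis by (simp add: card_cartesian_product)
qed

lemma card_Collect_fst:
  "card {(x::'a::finite, y::'b::finite). P x} = card {x. P x} * CARD('b)"
proof -
  have "{(x, y::'b). P x} = {x. P x} \<times> UNIV" by auto
  then show ?thesis by (simp add: card_cartesian_product)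
qed

text \<open>Drops a coordinate that an equation expresses through the other one, such as
  \<open>q = - (r^2)\<close> for invariant planes.\<close>

lemma card_Collect_graph:
  "card {(x, y). x = f y \<and> P y} = card {y. P y}"
  "card {(x, y). P x \<and> y = h x} = card {x. P x}"
  by (rule card_eq_by_witness[of _ snd _ "\<lambda>y. (f y, y)"]; auto)
    (rule card_eq_by_witness[of _ fst _ "\<lambda>x. (x, h x)"]; auto)

lemma card_True_3_4:
  "card {(x::'a::finite, y::'b::finite, z::'c::finite). True} = CARD('a) * CARD('b) * CARD('c)"
  "card {(x::'a::finite, y::'b::finite, z::'c::finite, w::'d::finite). True} =
    CARD('a) * CARD('b) * CARD('c) * CARD('d)"
  by (simp_all add: split_beta')

lemma one_plus_mult_eq_0_iff:
  fixes b :: "'k::field"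
  assumes "b \<noteq> 0"
  shows "1 + q * b = 0 \<longleftrightarrow> q = - (1 / b)"
proof -
  have "1 + q * b = b * (q + 1 / b)"
    using assms by (simp add: distrib_left mult.commute)
  then show ?thesis
    using assms by (simp only: eq_neg_iff_add_eq_0 mult_eq_0_iff simp_thms)
qed

text \<open>Writing the field size as a successor makes the number of nonzero elements a plain
  \<open>n\<close>, without subtraction on naturals.\<close>

lemma card_field_Suc: obtains n where "CARD('k::{field,finite}) = Suc n"
  by (metis finite_UNIV_card_ge_0 finite gr0_implies_Suc)

section \<open>Subalgebra counts\<close>

lemma counts_M1:
  "count_codim (M1 :: 'k::{field,finite} ^ 4 \<Rightarrow> _) 1 = 1 + CARD('k) + CARD('k)^2 + CARD('k)^3"
  "count_codim (M1 :: 'k::{field,finite} ^ 4 \<Rightarrow> _) 2 =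
    (1 + CARD('k) + CARD('k)^2) * (1 + CARD('k)^2)"
  by (simp_all only: subalgebra_count_1[OF lie_algebra_M(1)] subalgebra_count_2[OF lie_algebra_M(1)])
    (simp_all add: M1_def card_True_3_4 algebra_simps eval_nat_numeral)

text \<open>Here \<open>[x, y]\<close> is \<open>x $ 4 *s y - y $ 4 *s x\<close>, a combination of x
  and y. So every subspace is a subalgebra and the numbers are those of the abelian algebra.\<close>

lemma counts_M2:
  "count_codim (M2 :: 'k::{field,finite} ^ 4 \<Rightarrow> _) 1 = 1 + CARD('k) + CARD('k)^2 + CARD('k)^3"
  "count_codim (M2 :: 'k::{field,finite} ^ 4 \<Rightarrow> _) 2 =
    (1 + CARD('k) + CARD('k)^2) * (1 + CARD('k)^2)"
  by (simp_all only: subalgebra_count_1[OF lie_algebra_M(2)] subalgebra_count_2[OF lie_algebra_M(2)])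
    (simp_all add: M2_def axis_def card_True_3_4 algebra_simps eval_nat_numeral)

lemma counts_M3_0:
  "count_codim (M3 (0::'k::{field,finite})) 1 = CARD('k)^2 + 2 * CARD('k) + 1"
  "count_codim (M3 (0::'k)) 2 = CARD('k)^3 + 3 * CARD('k)^2 + CARD('k) + 1"
  by (simp_all only: subalgebra_count_1[OF lie_algebra_M(3)] subalgebra_count_2[OF lie_algebra_M(3)])
    (simp_all add: M3_def axis_def card_Collect_snd card_Collect_fst card_True_3_4 add_eq_0_iff
      eval_nat_numeral)

text \<open>On the span of \<open>e 1\<close>, \<open>e 2\<close>, \<open>e 3\<close> the
  eigenvalues of \<open>ad (e 4)\<close> are 1, 1 and \<open>a\<close>. For
  \<open>a \<noteq> 1\<close> the map is diagonalisable, with \<open>CARD('k) + 2\<close> eigenlines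
  and as many invariant planes; for \<open>a = 1\<close> there is a Jordan block and one fewer of
  each.\<close>

lemma counts_M3:
  fixes a :: "'k::{field,finite}"
  assumes "a \<noteq> 0"
  shows "count_codim (M3 a) 1 =
      (if a = 1 then CARD('k)^2 + CARD('k) + 1 else CARD('k)^2 + 2 * CARD('k) + 1)"
    and "count_codim (M3 a) 2 = (if a = 1 then CARD('k)^3 + 2 * CARD('k)^2 + CARD('k) + 1
     else CARD('k)^3 + 3 * CARD('k)^2 + CARD('k) + 1)"
proof -
  have quad: "1 + (r * a + r) = - (r * (a * r)) \<longleftrightarrow> r = -1 \<or> r = - (1 / a)" for r
  proof -
    have "1 + (r * a + r) = - (r * (a * r)) \<longleftrightarrow> (1 + r) * (1 + r * a) = 0"
      unfolding eq_neg_iff_add_eq_0 by (simp add: algebra_simps)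
    then show ?thesis
      unfolding mult_eq_0_iff one_plus_mult_eq_0_iff[OF assms] by (simp add: add_eq_0_iff)
  qed
  \<comment> \<open>The plane coordinate \<open>r\<close> is -1 / \<lambda>: at \<lambda> = 1 the
    entry \<open>q\<close> is free, since this eigenspace of the transpose contains a whole line of
    planes of the cell, and at \<lambda> = a it is 0. The two merge when
    \<open>a = 1\<close>.\<close>
  have "{(q, r). q * a = - (q * (a * r)) \<and> 1 + (r * a + r) = - (r * (a * r))} =
      (if a = 1 then UNIV \<times> {-1} else UNIV \<times> {-1} \<union> {(0, -1 / a)})"
    using assms by (auto simp: quad)
  then have inv: "card {(q, r). q * a = - (q * (a * r)) \<and> 1 + (r * a + r) = - (r * (a * r))} =
      (if a = 1 then CARD('k) else CARD('k) + 1)"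
    using assms by (auto simp: card_cartesian_product)
  have eig: "card {r. 1 + (r * a + r) = - (r * (a * r))} = (if a = 1 then 1 else 2)"
  proof -
    have "{r. 1 + (r * a + r) = - (r * (a * r))} = {-1, -1/a}" by (auto simp: quad)
    then show ?thesis using assms by (auto simp: card_insert_if field_simps)
  qed
  have "card {(r, s). - (s * a) = r \<and> r + s * a = 0} = CARD('k)"
    by (rule card_eq_by_witness[where f = snd and g = "\<lambda>s. (- (s * a), s)"]) auto
  note [simp] = inv eig this card_Collect_snd
  show "count_codim (M3 a) 1 =
      (if a = 1 then CARD('k)^2 + CARD('k) + 1 else CARD('k)^2 + 2 * CARD('k) + 1)"
    unfolding subalgebra_count_1[OF lie_algebra_M(3)]
    by (simp add: M3_def axis_def mult.assoc assms power2_eq_square)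
  show "count_codim (M3 a) 2 = (if a = 1 then CARD('k)^3 + 2 * CARD('k)^2 + CARD('k) + 1
     else CARD('k)^3 + 3 * CARD('k)^2 + CARD('k) + 1)"
    unfolding subalgebra_count_2[OF lie_algebra_M(3)]
    by (simp add: M3_def axis_def mult.assoc assms power2_eq_square power3_eq_cube)
qed

text \<open>\<open>ad (e 4)\<close> is diagonalisable with eigenvectors \<open>e 1\<close>,
  \<open>e 2 - e 3\<close> for 0 and \<open>e 3\<close> for 1, giving \<open>CARD('k) + 2\<close>
  eigenlines and as many invariant planes.\<close>

lemma counts_M4:
  "count_codim (M4 :: 'k::{field,finite} ^ 4 \<Rightarrow> _) 1 = CARD('k)^2 + 2 * CARD('k) + 1"
  "count_codim (M4 :: 'k::{field,finite} ^ 4 \<Rightarrow> _) 2 = CARD('k)^3 + 3 * CARD('k)^2 + CARD('k) + 1"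
proof -
  have "{(q::'k, r::'k). q = 0 \<and> 1 + r = 0} = {(0, -1)}"
    by (auto simp: add_eq_0_iff)
  moreover have "card {(r::'k, s). r + s = 0} = CARD('k)"
    by (rule card_eq_by_witness[where f = snd and g = "\<lambda>s. (- s, s)"]) (auto simp: add_eq_0_iff2)
  moreover have "card {r::'k. 1 + r = 0} = 1"
    by (simp add: add_eq_0_iff)
  ultimately show "count_codim (M4 :: 'k ^ 4 \<Rightarrow> _) 1 = CARD('k)^2 + 2 * CARD('k) + 1"
    "count_codim (M4 :: 'k ^ 4 \<Rightarrow> _) 2 = CARD('k)^3 + 3 * CARD('k)^2 + CARD('k) + 1"
    unfolding subalgebra_count_1[OF lie_algebra_M(4)] subalgebra_count_2[OF lie_algebra_M(4)]
    by (simp_all add: M4_def axis_def card_Collect_snd eval_nat_numeral)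
qed

text \<open>\<open>ad (e 4)\<close> has square zero and image spanned by \<open>e 3\<close>: the
  invariant planes are those containing \<open>e 3\<close>, the eigenlines are those in the span of
  \<open>e 1\<close> and \<open>e 3\<close>.\<close>

lemma counts_M5:
  "count_codim (M5 :: 'k::{field,finite} ^ 4 \<Rightarrow> _) 1 = CARD('k)^2 + CARD('k) + 1"
  "count_codim (M5 :: 'k::{field,finite} ^ 4 \<Rightarrow> _) 2 = CARD('k)^3 + 2 * CARD('k)^2 + CARD('k) + 1"
  by (simp_all only: subalgebra_count_1[OF lie_algebra_M(5)] subalgebra_count_2[OF lie_algebra_M(5)])
    (simp_all add: M5_def axis_def card_Collect_snd card_Collect_fst eval_nat_numeral)


text \<open>The plane is the kernel of the functional with values q, r, -1 on \<open>e 1\<close>,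
  \<open>e 2\<close>, \<open>e 3\<close>. Invariance makes it an eigenvector of the transpose, and
  evaluation at \<open>e 2\<close> and \<open>e 1\<close> gives \<lambda> r = -1 and \<lambda> q =
  r; hence r = -1 / \<lambda> and q = -r^2.\<close>

lemma invariant_plane_iff:
  fixes a b :: "'k::field"
  shows "q = q * (a * q) + (1 + q * b) * r \<and> 1 + r = r * (a * q) + r * (b * r) \<longleftrightarrow>
      q = - (r^2) \<and> a * r^3 - b * r^2 + r + 1 = 0"
  by (intro iffI conjI; elim conjE; algebra)

lemma invariant_plane_iff_nilp:
  fixes a b :: "'k::field"
  shows "q * (a * q) + (1 + q * b) * r = 0 \<and> r * (a * q) + r * (b * r) = 1 \<longleftrightarrow>
      q = - (r^2) \<and> a * r^3 - b * r^2 + 1 = 0"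
  by (intro iffI conjI; elim conjE; algebra)

text \<open>The line is spanned by \<open>e 1 + (r *s e 2 + s *s e 3)\<close>. Its image has first
  coordinate \<open>a * s\<close>, which is therefore the eigenvalue, and the other two coordinates
  give the equations.\<close>

lemma eigenline_iff:
  fixes a b :: "'k::field"
  shows "1 + s * b = s * (a * r) \<and> r + s = s * (a * s) \<longleftrightarrow>
    r = a * s^2 - s \<and> - (a^2) * s^3 + a * s^2 + b * s + 1 = 0"
  by (intro iffI conjI; elim conjE; algebra)

lemma eigenline_iff_nilp:
  fixes a b :: "'k::field"
  shows "1 + s * b = s * (a * r) \<and> r = s * (a * s) \<longleftrightarrow>
    r = a * s^2 \<and> a^2 * s^3 - b * s - 1 = 0"
  by (intro iffI conjI; elim conjE; algebra)

lemma counts_M6: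
  fixes a b :: "'k::{field,finite}"
  assumes "a \<noteq> 0"
  shows "count_codim (M6 a b) 1 = 1 + CARD('k) * V6_2 a b"
    and "count_codim (M6 a b) 2 = 1 + CARD('k) + CARD('k)^2 + CARD('k)^2 * V6_1 a b"
proof -
  \<comment> \<open>The condition for an eigenline spanned by \<open>e 2 + r *s e 3\<close>: with
    \<open>a \<noteq> 0\<close> the first coordinate of the image forces \<open>r = 0\<close>, but
    \<open>e 2\<close> is sent to \<open>e 3\<close>.\<close>
  have empty: "{r. r = 0 \<and> 1 + r = r * (b * r)} = {}"
    by auto
  show "count_codim (M6 a b) 1 = 1 + CARD('k) * V6_2 a b"
    and "count_codim (M6 a b) 2 = 1 + CARD('k) + CARD('k)^2 + CARD('k)^2 * V6_1 a b"
    unfolding subalgebra_count_1[OF lie_algebra_M(6)] subalgebra_count_2[OF lie_algebra_M(6)]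
    by (simp_all add: M6_def axis_def mult.assoc assms empty card_Collect_snd card_Collect_graph
        invariant_plane_iff eigenline_iff V6_1_def V6_2_def power2_eq_square[of "CARD('k)"])
qed

text \<open>The eigenvalue 0 contributes the plane spanned by \<open>e 2\<close>, \<open>e 3\<close>
  and one kernel line. The others satisfy \<lambda>^2 - \<lambda> - b = 0, and \<open>V3\<close>
  serves planes (root -1 / \<lambda>) as well as lines (root \<lambda> / b), because the two roots
  \<lambda> have product -b.\<close>

lemma counts_M6_0:
  fixes b :: "'k::{field,finite}"
  assumes "b \<noteq> 0"
  shows "count_codim (M6 0 b) 1 = 1 + CARD('k) + CARD('k) * V3 b"
    and "count_codim (M6 0 b) 2 = 1 + CARD('k) + 2 * CARD('k)^2 + CARD('k)^2 * V3 b"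
proof -
  have eig: "1 + r = r * (b * r) \<longleftrightarrow> b * r^2 - r = 1" for r
    by (auto simp: algebra_simps power2_eq_square)
  have inv: "q = (1 + q * b) * r \<and> b * r^2 - r = 1 \<longleftrightarrow> q = - (r^2) \<and> b * r^2 - r = 1" for q r
    by (intro iffI conjI; elim conjE; (assumption | algebra))
  \<comment> \<open>The kernel of \<open>ad (e 4)\<close> is spanned by
    \<open>e 1 + (1 / b) *s e 2 - (1 / b) *s e 3\<close>.\<close>
  have null: "{(r, s). 1 + s * b = 0 \<and> r + s = 0} = {(1 / b, - (1 / b))}"
    using assms by (auto simp: one_plus_mult_eq_0_iff)
  show "count_codim (M6 0 b) 1 = 1 + CARD('k) + CARD('k) * V3 b"
    and "count_codim (M6 0 b) 2 = 1 + CARD('k) + 2 * CARD('k)^2 + CARD('k)^2 * V3 b"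
    unfolding subalgebra_count_1[OF lie_algebra_M(6)] subalgebra_count_2[OF lie_algebra_M(6)]
    by (simp_all add: M6_def axis_def mult.assoc assms eig inv null card_Collect_snd card_Collect_graph
        V3_def power2_eq_square[of "CARD('k)"])
qed

text \<open>A nilpotent Jordan block of size 2 and the simple eigenvalue 1: two eigenlines and two
  invariant planes.\<close>

lemma counts_M6_0_0:
  "count_codim (M6 0 (0 :: 'k::{field,finite})) 1 = 1 + 2 * CARD('k)"
  "count_codim (M6 0 (0 :: 'k::{field,finite})) 2 = 1 + CARD('k) + 3 * CARD('k)^2"
  unfolding subalgebra_count_1[OF lie_algebra_M(6)] subalgebra_count_2[OF lie_algebra_M(6)]
  by (simp_all add: M6_def axis_def card_Collect_snd card_Collect_graph add_eq_0_iff power2_eq_square)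

lemma counts_M7:
  fixes a b :: "'k::{field,finite}"
  assumes "a \<noteq> 0"
  shows "count_codim (M7 a b) 1 = 1 + CARD('k) * V7_2 a b"
    and "count_codim (M7 a b) 2 = 1 + CARD('k) + CARD('k)^2 + CARD('k)^2 * V7_1 a b"
  unfolding subalgebra_count_1[OF lie_algebra_M(7)] subalgebra_count_2[OF lie_algebra_M(7)]
  by (simp_all add: M7_def axis_def mult.assoc assms card_Collect_snd card_Collect_graph
      invariant_plane_iff_nilp eigenline_iff_nilp V7_1_def V7_2_def power2_eq_square)

lemma counts_M7_0:
  fixes b :: "'k::{field,finite}"
  assumes "b \<noteq> 0"
  shows "count_codim (M7 0 b) 1 = 1 + CARD('k) + CARD('k) * V4 b"
    and "count_codim (M7 0 b) 2 = 1 + CARD('k) + 2 * CARD('k)^2 + CARD('k)^2 * V4 b"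
proof -
  have eig: "r * (b * r) = 1 \<longleftrightarrow> b * r^2 - 1 = 0" for r
    by (simp add: algebra_simps power2_eq_square)
  have inv: "(1 + q * b = 0 \<or> r = 0) \<and> b * r^2 - 1 = 0 \<longleftrightarrow> q = - (1 / b) \<and> b * r^2 - 1 = 0" for q r
    using assms by (auto simp: one_plus_mult_eq_0_iff)
  have null: "{(r, s). 1 + s * b = 0 \<and> r = 0} = {(0, - (1 / b))}"
    using assms by (auto simp: one_plus_mult_eq_0_iff)
  show "count_codim (M7 0 b) 1 = 1 + CARD('k) + CARD('k) * V4 b"
    and "count_codim (M7 0 b) 2 = 1 + CARD('k) + 2 * CARD('k)^2 + CARD('k)^2 * V4 b"
    unfolding subalgebra_count_1[OF lie_algebra_M(7)] subalgebra_count_2[OF lie_algebra_M(7)]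
    by (simp_all add: M7_def axis_def mult.assoc assms eig inv null card_Collect_snd card_Collect_graph
        V4_def power2_eq_square[of "CARD('k)"] del: right_minus_eq)
qed

text \<open>A single nilpotent Jordan block of size 3: one eigenline and one invariant
  plane.\<close>

lemma counts_M7_0_0:
  "count_codim (M7 0 (0 :: 'k::{field,finite})) 1 = 1 + CARD('k)"
  "count_codim (M7 0 (0 :: 'k::{field,finite})) 2 = 1 + CARD('k) + 2 * CARD('k)^2"
  unfolding subalgebra_count_1[OF lie_algebra_M(7)] subalgebra_count_2[OF lie_algebra_M(7)]
  by (simp_all add: M7_def axis_def card_Collect_snd power2_eq_square)

lemma counts_M8:
  "count_codim (M8 :: 'k::{field,finite} ^ 4 \<Rightarrow> _) 1 = 1 + 3 * CARD('k)"
  "count_codim (M8 :: 'k::{field,finite} ^ 4 \<Rightarrow> _) 2 = 1 + CARD('k) + 4 * CARD('k)^2"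
proof -
  \<comment> \<open>The values 0 and 1 of a coordinate are exceptional below, so the field size is
    written as \<open>n + 2\<close>.\<close>
  have "card {0::'k, 1} \<le> CARD('k)" by (rule card_mono) auto
  then obtain n where n: "CARD('k) = n + 2"
    by (auto simp: le_iff_add)
  have c1: "card (UNIV - {0::'k}) = n + 1" and c2: "card (UNIV - {0::'k, 1}) = n"
    by (simp_all add: card_Diff_subset n)
  have "{(p::'k, q::'k, r::'k). (q = 0 \<or> p = 0) \<and> (r = 0 \<or> p = 0) \<and> r = 0} =
      UNIV \<times> {0} \<times> {0} \<union> {0} \<times> (UNIV - {0}) \<times> {0}"
    by auto
  then have A: "card {(p::'k, q::'k, r::'k). (q = 0 \<or> p = 0) \<and> (r = 0 \<or> p = 0) \<and> r = 0} = 2 * n + 3"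
    by (simp only:, subst card_Un_disjoint) (auto simp: card_cartesian_product c1 n)
  \<comment> \<open>The three disjoint pieces are \<open>s = 0\<close>, \<open>s = 1\<close> and all
    other \<open>s\<close>.\<close>
  have "{(p::'k, q::'k, r::'k, s::'k). (p = 0 \<or> s = 1) \<and> (s = 0 \<or> q = 0)} =
      {0} \<times> UNIV \<times> UNIV \<times> {0} \<union> (UNIV \<times> {0} \<times> UNIV \<times> {1} \<union> {0} \<times> {0} \<times> UNIV \<times> (UNIV - {0, 1}))"
    by auto
  then have B: "card {(p::'k, q::'k, r::'k, s::'k). (p = 0 \<or> s = 1) \<and> (s = 0 \<or> q = 0)} =
      (n + 2) * (n + 2) + ((n + 2) * (n + 2) + (n + 2) * n)"
    by (simp add: card_Un_disjoint card_cartesian_product c2 n disjoint_iff)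
  have "{(p::'k, q::'k, r::'k). (r = 0 \<or> p = 0) \<and> (r = 0 \<or> p = q)} =
      UNIV \<times> UNIV \<times> {0} \<union> {0} \<times> {0} \<times> (UNIV - {0})"
    by auto
  then have C: "card {(p::'k, q::'k, r::'k). (r = 0 \<or> p = 0) \<and> (r = 0 \<or> p = q)} =
      (n + 2) * (n + 2) + (n + 1)"
    by (simp only:, subst card_Un_disjoint) (auto simp: card_cartesian_product c1 n)
  show "count_codim (M8 :: 'k ^ 4 \<Rightarrow> _) 1 = 1 + 3 * CARD('k)"
    "count_codim (M8 :: 'k ^ 4 \<Rightarrow> _) 2 = 1 + CARD('k) + 4 * CARD('k)^2"
    unfolding subalgebra_count_1[OF lie_algebra_M(8)] subalgebra_count_2[OF lie_algebra_M(8)]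
    by (simp_all add: M8_def axis_def mult.assoc A B C n card_Collect_fst card_Collect_snd power2_eq_square)
qed

text \<open>The span of \<open>e 3\<close>, \<open>e 4\<close> acts on the span U of
  \<open>e 1\<close>, \<open>e 2\<close> as the quadratic extension acts on itself by
  multiplication, so only multiples of \<open>ad (e 3)\<close> stabilise a line of U.
  Three-dimensional subalgebras therefore contain U; two-dimensional ones are U, its abelian
  complements, or a line of U together with some \<open>e 3 + v\<close>, v in U.\<close>

lemma counts_M9:
  fixes a :: "'k::{field,finite}"
  assumes irred: "\<nexists>x. x^2 - x - a = 0"
  shows "count_codim (M9 a) 1 = 1 + CARD('k)"
    and "count_codim (M9 a) 2 = 1 + CARD('k) + 2 * CARD('k)^2"
proof -
  \<comment> \<open>Equality would make \<open>e 1 + x *s e 2\<close> an eigenvector of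
    \<open>ad (e 4)\<close> with eigenvalue \<open>1 + x\<close>; the root contradicting
    \<open>irred\<close> is the conjugate one, \<open>- x\<close>.\<close>
  have ne: "a \<noteq> (1 + x) * x" for x
    using irred[simplified, rule_format, of "- x"] by (auto simp: power2_eq_square algebra_simps)
  obtain n where n: "CARD('k) = Suc n"
    by (rule card_field_Suc)
  have c1: "card (UNIV - {0::'k}) = n"
    by (simp add: card_Diff_subset n)
  have "r = 0 \<and> q = 0" if "(1 + p) * q + a * r = 0" "q + p * r = 0" for p q r
  proof -
    have "q = - (p * r)"
      using that(2) by (simp add: add_eq_0_iff2)
    then have "r * (a - (1 + p) * p) = 0"
      using that(1) by (simp add: algebra_simps)
    then have "r = 0"
      using ne[of p] by simp
    then show ?thesis
      using that(2) by simp
  qed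
  then have "(1 + p) * q + a * r = 0 \<and> q + p * r = 0 \<longleftrightarrow> q = 0 \<and> r = 0" for p q r
    by (metis add.right_neutral mult_zero_right)
  then have "{(p, q, r). (1 + p) * q + a * r = 0 \<and> q + p * r = 0} = UNIV \<times> {0} \<times> {0}"
    by auto
  then have A: "card {(p, q, r). (1 + p) * q + a * r = 0 \<and> q + p * r = 0} = Suc n"
    by (simp add: card_cartesian_product n)
  have B: "{(p, q). a = (1 + q) * q \<and> p = 0} = {}"
    using ne by auto
  \<comment> \<open>With \<open>s = 0\<close> the second row would be an eigenvector in the span of
    \<open>e 1\<close>, \<open>e 2\<close>. The solutions with \<open>s \<noteq> 0\<close> are
    complements of that span, determined by \<open>r\<close> and \<open>s\<close>.\<close>
  have iff: "a + (q * r - p * s) = (1 + (r + q)) * r \<and> (1 + (r + q) = 0 \<or> s = 0) \<longleftrightarrow>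
      s \<noteq> 0 \<and> q = - (1 + r) \<and> p = (a - (1 + r) * r) / s" for p q r s
  proof (cases "s = 0")
    case True
    then show ?thesis using ne[of r] by (auto simp: algebra_simps)
  next
    case False
    then have "1 + (r + q) = 0 \<longleftrightarrow> q = - (1 + r)"
      by (simp only: eq_neg_iff_add_eq_0 ac_simps)
    then show ?thesis using False by (auto simp: eq_divide_eq algebra_simps)
  qed
  have C: "card {(p, q, r, s). a + (q * r - p * s) = (1 + (r + q)) * r \<and>
      (1 + (r + q) = 0 \<or> s = 0)} = card ((UNIV :: 'k set) \<times> (UNIV - {0::'k}))"
    unfolding iff
    by (rule card_eq_by_witness[where f = "\<lambda>(p, q, r, s). (r, s)"
          and g = "\<lambda>(r, s). ((a - (1 + r) * r) / s, - (1 + r), r, s)"]) auto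
  have D: "card {(p::'k, q::'k, r). p * r = 1 \<and> (q = 0 \<or> r = 0)} = card (UNIV - {0::'k})"
    by (rule card_eq_by_witness[where f = "\<lambda>(p, q, r). r" and g = "\<lambda>r. (1 / r, 0, r)"])
      (auto simp: eq_divide_eq divide_eq_eq)
  show "count_codim (M9 a) 1 = 1 + CARD('k)"
    and "count_codim (M9 a) 2 = 1 + CARD('k) + 2 * CARD('k)^2"
    unfolding subalgebra_count_1[OF lie_algebra_M(9)] subalgebra_count_2[OF lie_algebra_M(9)]
    by (simp_all add: M9_def axis_def mult.assoc A B C D c1 n card_cartesian_product power2_eq_square)
qed

text \<open>The span of \<open>e 1\<close>, \<open>e 2\<close>, \<open>e 3\<close> is a Heisenberg
  algebra with centre \<open>e 2\<close>, graded by \<open>e 4\<close>. Three-dimensional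
  subalgebras are exactly the hyperplanes through \<open>e 2\<close>, because \<open>e 4\<close>
  acts as the identity on the other two directions modulo \<open>e 2\<close>.\<close>

lemma counts_M12:
  "count_codim (M12 :: 'k::{field,finite} ^ 4 \<Rightarrow> _) 1 = 1 + CARD('k) + CARD('k)^2"
  "count_codim (M12 :: 'k::{field,finite} ^ 4 \<Rightarrow> _) 2 = 1 + CARD('k) + 2 * CARD('k)^2 + CARD('k)^3"
proof -
  obtain n where n: "CARD('k) = Suc n"
    by (rule card_field_Suc)
  have c1: "card (UNIV - {0::'k}) = n"
    by (simp add: card_Diff_subset n)
  \<comment> \<open>The disjunct \<open>2 = 1\<close> arises from cancelling \<open>r\<close> in
    \<open>r = 2 * r\<close>; the conjunct \<open>r = 0\<close> settles the count in every
    characteristic.\<close>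
  have "{(p::'k, q::'k, r::'k). (p = 0 \<or> r = 0) \<and> (r = 0 \<or> (2::'k) = 1) \<and> r = 0} = UNIV \<times> UNIV \<times> {0}"
    by auto
  then have A: "card {(p::'k, q::'k, r::'k). (p = 0 \<or> r = 0) \<and> (r = 0 \<or> (2::'k) = 1) \<and> r = 0} = Suc n * Suc n"
    by (simp add: card_cartesian_product n)
  have B: "card {(q::'k, r, s::'k). r + q = 0} = card (UNIV :: ('k \<times> 'k) set)"
    by (rule card_eq_by_witness[where f = snd and g = "\<lambda>(r, s). (- r, r, s)"])
      (auto simp: add_eq_0_iff)
  have C1: "card {(p::'k, q::'k, r). p * r = 1} = card (UNIV \<times> (UNIV - {0}) :: ('k \<times> 'k) set)"
    by (rule card_eq_by_witness[where f = snd and g = "\<lambda>(q, r). (1 / r, q, r)"])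
      (auto simp: eq_divide_eq divide_eq_eq)
  have "{(p::'k, q::'k, r). r = 0 \<or> p * r = 1} = UNIV \<times> UNIV \<times> {0} \<union> {(p, q, r). p * r = 1}"
    by auto
  then have C: "card {(p::'k, q::'k, r). r = 0 \<or> p * r = 1} = Suc n * Suc n + Suc n * n"
    by (simp only:, subst card_Un_disjoint) (auto simp: card_cartesian_product C1 c1 n)
  show "count_codim (M12 :: 'k ^ 4 \<Rightarrow> _) 1 = 1 + CARD('k) + CARD('k)^2"
    "count_codim (M12 :: 'k ^ 4 \<Rightarrow> _) 2 = 1 + CARD('k) + 2 * CARD('k)^2 + CARD('k)^3"
    unfolding subalgebra_count_1[OF lie_algebra_M(10)] subalgebra_count_2[OF lie_algebra_M(10)]
    by (simp_all add: M12_def axis_def mult.assoc A B C n card_Collect_fst card_Collect_snd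
        card_cartesian_product power2_eq_square power3_eq_cube)
qed

text \<open>Again a Heisenberg algebra with centre \<open>e 2\<close>. Modulo the centre,
  \<open>e 1 + x *s e 3\<close> is an eigenvector of \<open>ad (e 4)\<close> iff
  \<open>a = (1 + x) * x\<close>, which is the equation of \<open>V13\<close>.\<close>

lemma counts_M13:
  fixes a :: "'k::{field,finite}"
  shows "count_codim (M13 a) 1 = 1 + CARD('k) * V13 a"
    and "count_codim (M13 a) 2 = 1 + CARD('k) + CARD('k)^2 + CARD('k)^2 * V13 a"
proof -
  have V: "V13 a = card {x. a = (1 + x) * x}"
    unfolding V13_def by (rule arg_cong[where f = card]) (auto simp: algebra_simps power2_eq_square)
  have "{(p, q, r). a = (1 + q) * q + p * r \<and> r * q + r = 0 \<and> r = 0} =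
      UNIV \<times> {x. a = (1 + x) * x} \<times> {0}"
    by auto
  then have A: "card {(p, q, r). a = (1 + q) * q + p * r \<and> r * q + r = 0 \<and> r = 0} = CARD('k) * V13 a"
    by (simp add: card_cartesian_product V)
  have B: "card {(q, r, s). r + q = (1 + s) * r \<and> a = (1 + s) * s} =
      card ((UNIV :: 'k set) \<times> {x. a = (1 + x) * x})"
    by (rule card_eq_by_witness[where f = snd and g = "\<lambda>(r, s). (s * r, r, s)"])
      (auto simp: algebra_simps)
  have "{(p::'k, q::'k, r::'k). r = 0 \<and> (p * r = 1 \<or> r = 0)} = UNIV \<times> UNIV \<times> {0}"
    by auto
  then have C: "card {(p::'k, q::'k, r::'k). r = 0 \<and> (p * r = 1 \<or> r = 0)} = CARD('k)^2"
    by (simp add: card_cartesian_product power2_eq_square)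
  show "count_codim (M13 a) 1 = 1 + CARD('k) * V13 a"
    and "count_codim (M13 a) 2 = 1 + CARD('k) + CARD('k)^2 + CARD('k)^2 * V13 a"
    unfolding subalgebra_count_1[OF lie_algebra_M(11)] subalgebra_count_2[OF lie_algebra_M(11)]
    by (simp_all add: M13_def axis_def mult.assoc A B C card_Collect_snd card_cartesian_product
        V power2_eq_square[of "CARD('k)"])
qed

text \<open>The same structure, but \<open>ad (e 4)\<close> has trace 0 modulo the centre
  \<open>e 2\<close>, so the slope \<open>x\<close> of an eigenline satisfies
  \<open>a = x * x\<close>.\<close>

lemma counts_M14:
  fixes a :: "'k::{field,finite}"
  shows "count_codim (M14 a) 1 = 1 + CARD('k) * V14 a"
    and "count_codim (M14 a) 2 = 1 + CARD('k) + CARD('k)^2 + CARD('k)^2 * V14 a"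
proof -
  have V: "V14 a = card {x. a = x * x}"
    unfolding V14_def by (rule arg_cong[where f = card]) (auto simp: power2_eq_square)
  have "{(p, q, r). a = q * q + p * r \<and> (r = 0 \<or> q = 0) \<and> r = 0} =
      UNIV \<times> {x. a = x * x} \<times> {0}"
    by auto
  then have A: "card {(p, q, r). a = q * q + p * r \<and> (r = 0 \<or> q = 0) \<and> r = 0} = CARD('k) * V14 a"
    by (simp add: card_cartesian_product V)
  have B: "card {(q, r, s). q = s * r \<and> a = s * s} = card ((UNIV :: 'k set) \<times> {x. a = x * x})"
    by (rule card_eq_by_witness[where f = snd and g = "\<lambda>(r, s). (s * r, r, s)"]) auto
  have "{(p::'k, q::'k, r::'k). r = 0 \<and> (p = 0 \<or> r = 0)} = UNIV \<times> UNIV \<times> {0}"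
    by auto
  then have C: "card {(p::'k, q::'k, r::'k). r = 0 \<and> (p = 0 \<or> r = 0)} = CARD('k)^2"
    by (simp add: card_cartesian_product power2_eq_square)
  show "count_codim (M14 a) 1 = 1 + CARD('k) * V14 a"
    and "count_codim (M14 a) 2 = 1 + CARD('k) + CARD('k)^2 + CARD('k)^2 * V14 a"
    unfolding subalgebra_count_1[OF lie_algebra_M(12)] subalgebra_count_2[OF lie_algebra_M(12)]
    by (simp_all add: M14_def axis_def mult.assoc A B C card_Collect_snd card_cartesian_product
        V power2_eq_square[of "CARD('k)"])
qed

section \<open>Relations between the point counts\<close>

lemma card_roots_reciprocal:
  fixes a :: "'k::field"
  assumes "a \<noteq> 0" "\<not> P 0" "\<not> Q 0"
    and iff: "\<And>x y. a * x * y = - 1 \<Longrightarrow> P x \<longleftrightarrow> Q y"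
  shows "card {x. P x} = card {y. Q y}"
proof (rule card_eq_by_witness[where f = "\<lambda>x. - (1 / (a * x))" and g = "\<lambda>x. - (1 / (a * x))"])
  fix x assume x: "x \<in> {x. P x}"
  then have "x \<noteq> 0" using assms(2) by auto
  then show "- (1 / (a * x)) \<in> {y. Q y} \<and> - (1 / (a * - (1 / (a * x)))) = x"
    using x iff[of x "- (1 / (a * x))"] assms(1) by simp
next
  fix y assume y: "y \<in> {y. Q y}"
  then have "y \<noteq> 0" using assms(3) by auto
  then show "- (1 / (a * y)) \<in> {x. P x} \<and> - (1 / (a * - (1 / (a * y)))) = y"
    using y iff[of "- (1 / (a * y))" y] assms(1) by simp
qed

text \<open>The denominators of the Moebius map and of its inverse have product \<open>a\<close>, so
  neither vanishes at corresponding points.\<close>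

lemma moebius_denominators:
  fixes a b x y :: "'k::field"
  assumes "y * (b * x + 1) = - (a * x)"
  shows "(b * x + 1) * (b * y + a) = a"
proof -
  have "(b * x + 1) * (b * y + a) = b * (y * (b * x + 1)) + a * (b * x + 1)"
    by (simp add: algebra_simps)
  then show ?thesis
    unfolding assms by (simp add: algebra_simps)
qed

lemma card_roots_moebius:
  fixes a b :: "'k::field"
  assumes "a \<noteq> 0"
    and P: "\<And>x. P x \<Longrightarrow> b * x + 1 \<noteq> 0" and Q: "\<And>y. Q y \<Longrightarrow> b * y + a \<noteq> 0"
    and iff: "\<And>x y. y * (b * x + 1) = - (a * x) \<Longrightarrow> b * x + 1 \<noteq> 0 \<Longrightarrow> P x \<longleftrightarrow> Q y"
  shows "card {x. P x} = card {y. Q y}"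
proof (rule card_eq_by_witness[where f = "\<lambda>x. - (a * x) / (b * x + 1)" and g = "\<lambda>y. - y / (b * y + a)"])
  fix x assume x: "x \<in> {x. P x}"
  define y where "y = - (a * x) / (b * x + 1)"
  have ne: "b * x + 1 \<noteq> 0" using P x by simp
  then have xy: "y * (b * x + 1) = - (a * x)" by (simp add: y_def)
  then have "b * y + a \<noteq> 0" using moebius_denominators[of y b x a] assms(1) by fastforce
  moreover have "x * (b * y + a) = - y" using xy by (simp add: algebra_simps eq_neg_iff_add_eq_0)
  ultimately have "- y / (b * y + a) = x" by (metis nonzero_eq_divide_eq)
  moreover have "Q y" using iff[OF xy ne] x by simp
  ultimately show "- (a * x) / (b * x + 1) \<in> {y. Q y} \<and>
      - (- (a * x) / (b * x + 1)) / (b * (- (a * x) / (b * x + 1)) + a) = x"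
    unfolding y_def[symmetric] by simp
next
  fix y assume y: "y \<in> {y. Q y}"
  define x where "x = - y / (b * y + a)"
  have ne: "b * y + a \<noteq> 0" using Q y by simp
  then have "x * (b * y + a) = - y" by (simp add: x_def)
  then have xy: "y * (b * x + 1) = - (a * x)" by (simp add: algebra_simps eq_neg_iff_add_eq_0)
  then have ne': "b * x + 1 \<noteq> 0" using moebius_denominators[of y b x a] assms(1) by fastforce
  then have "- (a * x) / (b * x + 1) = y" using xy by (metis nonzero_eq_divide_eq)
  moreover have "P x" using iff[OF xy ne'] y by simp
  ultimately show "- y / (b * y + a) \<in> {x. P x} \<and>
      - (a * (- y / (b * y + a))) / (b * (- y / (b * y + a)) + 1) = y"
    unfolding x_def[symmetric] by simp
qed

lemma V6_1_eq_V6_2: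
  fixes a b :: "'k::{field,finite}"
  assumes "a \<noteq> 0"
  shows "V6_1 a b = V6_2 a b"
  unfolding V6_1_def V6_2_def
proof (rule card_roots_reciprocal[OF assms])
  fix x y assume xy: "a * x * y = - 1"
  then have "x \<noteq> 0" by auto
  \<comment> \<open>The factor \<open>a^2 * x^3\<close> groups every power of \<open>y\<close> into
    the product \<open>a * x * y\<close>, whose value is -1.\<close>
  have "(a * y^3 - b * y^2 + y + 1) * (a^2 * x^3) =
      (a * x * y)^3 - b * x * (a * x * y)^2 + a * x^2 * (a * x * y) + a^2 * x^3"
    by (simp add: algebra_simps power2_eq_square power3_eq_cube)
  also have "\<dots> = - (- (a^2) * x^3 + a * x^2 + b * x + 1)"
    unfolding xy by simp
  finally show "- (a^2) * x^3 + a * x^2 + b * x + 1 = 0 \<longleftrightarrow> a * y^3 - b * y^2 + y + 1 = 0"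
    using assms \<open>x \<noteq> 0\<close> by (metis mult_eq_0_iff neg_equal_0_iff_equal power_not_zero)
qed auto

lemma V7_1_eq_V7_2:
  fixes a b :: "'k::{field,finite}"
  assumes "a \<noteq> 0"
  shows "V7_1 a b = V7_2 a b"
  unfolding V7_1_def V7_2_def
proof (rule card_roots_reciprocal[OF assms])
  fix x y assume xy: "a * x * y = - 1"
  then have "x \<noteq> 0" by auto
  have "(a * y^3 - b * y^2 + 1) * (a^2 * x^3) =
      (a * x * y)^3 - b * x * (a * x * y)^2 + a^2 * x^3"
    by (simp add: algebra_simps power2_eq_square power3_eq_cube)
  also have "\<dots> = a^2 * x^3 - b * x - 1"
    unfolding xy by simp
  finally show "a^2 * x^3 - b * x - 1 = 0 \<longleftrightarrow> a * y^3 - b * y^2 + 1 = 0"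
    using assms \<open>x \<noteq> 0\<close> by (metis mult_eq_0_iff power_not_zero)
qed auto

text \<open>At a root x = \<lambda> / a the denominator \<open>b * x + 1\<close> equals \<lambda>^2
  (\<lambda> - 1) / a. It vanishes only at \<lambda> = 1, which is an eigenvalue iff
  \<open>a + b = 0\<close>.\<close>

lemma V6_1_eq_V6_3:
  fixes a b :: "'k::{field,finite}"
  assumes "a \<noteq> 0" "a + b \<noteq> 0"
  shows "V6_1 a b = V6_3 a b"
  unfolding V6_1_def V6_3_def
proof (rule card_roots_moebius[OF assms(1), where b = b])
  fix x assume x: "- (a^2) * x^3 + a * x^2 + b * x + 1 = 0"
  show "b * x + 1 \<noteq> 0"
  proof
    assume 0: "b * x + 1 = 0"
    have "- (a^2) * x^3 + a * x^2 + b * x + 1 = a * x^2 * (1 - a * x) + (b * x + 1)"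
      by (simp add: algebra_simps power2_eq_square power3_eq_cube)
    moreover have "x \<noteq> 0" using 0 by auto
    ultimately have "1 - a * x = 0" using x 0 assms(1) by simp
    then have "(a + b) * x = 0" using 0 by (simp add: algebra_simps)
    then show False using \<open>x \<noteq> 0\<close> assms(2) by simp
  qed
next
  fix y assume y: "(a + b) * y^3 + (a + b^2) * y^2 + 2 * a * b * y + a^2 = 0"
  show "b * y + a \<noteq> 0"
  proof
    assume 0: "b * y + a = 0"
    have "(a + b) * y^3 + (a + b^2) * y^2 + 2 * a * b * y + a^2 =
        y^2 * (a * y + (b * y + a)) + (b * y + a)^2"
      by (simp add: algebra_simps power2_eq_square power3_eq_cube)
    then have "y = 0" using y 0 assms(1) by simp
    then show False using 0 assms(1) by simp
  qed
next
  fix x y assume xy: "y * (b * x + 1) = - (a * x)" and ne: "b * x + 1 \<noteq> 0"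
  have "((a + b) * y^3 + (a + b^2) * y^2 + 2 * a * b * y + a^2) * (b * x + 1)^3 =
      (a + b) * (y * (b * x + 1))^3 + (a + b^2) * (y * (b * x + 1))^2 * (b * x + 1) +
      2 * a * b * (y * (b * x + 1)) * (b * x + 1)^2 + a^2 * (b * x + 1)^3"
    unfolding power_mult_distrib by (simp add: distrib_right power2_eq_square power3_eq_cube mult.assoc)
  also have "\<dots> = a^2 * (- (a^2) * x^3 + a * x^2 + b * x + 1)"
    unfolding xy by (simp add: algebra_simps power2_eq_square power3_eq_cube)
  finally show "- (a^2) * x^3 + a * x^2 + b * x + 1 = 0 \<longleftrightarrow>
      (a + b) * y^3 + (a + b^2) * y^2 + 2 * a * b * y + a^2 = 0"
    using assms ne by (metis mult_eq_0_iff power_not_zero)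
qed

text \<open>For \<open>b = - a\<close> the root \<open>1 / a\<close>, of eigenvalue 1, goes to
  infinity under the Moebius map, and the cubic of \<open>V6_3\<close> loses its leading term. The
  summand 1 restores this root.\<close>

lemma V6_1_eq_V6_4:
  fixes a :: "'k::{field,finite}"
  assumes "a \<noteq> 0"
  shows "V6_1 a (- a) = 1 + V6_4 a (- a)"
proof -
  have factor: "- (a^2) * x^3 + a * x^2 + (- a) * x + 1 = (- a * x + 1) * (a * x^2 + 1)" for x
    by (simp add: algebra_simps power2_eq_square power3_eq_cube)
  \<comment> \<open>The roots are counted without multiplicity, and \<open>1 / a\<close> can also be
    a root of the quadratic factor (when \<open>a = - 1\<close>), so it is excluded
    explicitly.\<close>
  have rest: "card {x. - a * x + 1 \<noteq> 0 \<and> a * x^2 + 1 = 0} = V6_4 a (- a)"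
    unfolding V6_4_def
  proof (rule card_roots_moebius[OF assms, where b = "- a"])
    fix y assume y: "(a + (- a)^2) * y^2 + 2 * a * (- a) * y + a^2 = 0"
    have "(a + (- a)^2) * y^2 + 2 * a * (- a) * y + a^2 = a * y^2 + (- a * y + a)^2"
      by (simp add: algebra_simps power2_eq_square)
    then show "- a * y + a \<noteq> 0"
      using y assms by auto
  next
    fix x y assume xy: "y * (- a * x + 1) = - (a * x)" and ne: "- a * x + 1 \<noteq> 0"
    have "((a + (- a)^2) * y^2 + 2 * a * (- a) * y + a^2) * (- a * x + 1)^2 =
        (a + (- a)^2) * (y * (- a * x + 1))^2 + 2 * a * (- a) * (y * (- a * x + 1)) * (- a * x + 1) +
        a^2 * (- a * x + 1)^2"
      by (simp add: algebra_simps power2_eq_square)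
    also have "\<dots> = a^2 * (a * x^2 + 1)"
      unfolding xy by (simp add: algebra_simps power2_eq_square)
    finally show "- a * x + 1 \<noteq> 0 \<and> a * x^2 + 1 = 0 \<longleftrightarrow>
        (a + (- a)^2) * y^2 + 2 * a * (- a) * y + a^2 = 0"
      using assms ne by (metis mult_eq_0_iff power_not_zero)
  qed simp
  have roots: "{x. - (a^2) * x^3 + a * x^2 + (- a) * x + 1 = 0} =
      insert (1 / a) {x. - a * x + 1 \<noteq> 0 \<and> a * x^2 + 1 = 0}"
    unfolding factor using assms by (auto simp: eq_divide_eq mult.commute)
  have "1 / a \<notin> {x. - a * x + 1 \<noteq> 0 \<and> a * x^2 + 1 = 0}"
    using assms by simp
  then show ?thesis
    unfolding V6_1_def roots rest[symmetric] by (subst card_insert_disjoint) simp_all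
qed

text \<open>At a root the denominator \<open>b * x + 1\<close> equals \<open>a^2 * x^3\<close>,
  which is nonzero, so no root goes to infinity.\<close>

lemma V7_1_eq_V7_3:
  fixes a b :: "'k::{field,finite}"
  assumes "a \<noteq> 0"
  shows "V7_1 a b = V7_3 a b"
  unfolding V7_1_def V7_3_def
proof (rule card_roots_moebius[OF assms, where b = b])
  fix x assume x: "a^2 * x^3 - b * x - 1 = 0"
  show "b * x + 1 \<noteq> 0"
  proof
    assume 0: "b * x + 1 = 0"
    have "a^2 * x^3 - b * x - 1 = a^2 * x^3 - (b * x + 1)" by simp
    then show False using x 0 assms by simp
  qed
next
  fix y assume y: "a * y^3 + b^2 * y^2 + 2 * a * b * y + a^2 = 0"
  show "b * y + a \<noteq> 0"
  proof
    assume 0: "b * y + a = 0"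
    have "a * y^3 + b^2 * y^2 + 2 * a * b * y + a^2 = a * y^3 + (b * y + a)^2"
      by (simp add: algebra_simps power2_eq_square)
    then show False using y 0 assms by simp
  qed
next
  fix x y assume xy: "y * (b * x + 1) = - (a * x)" and ne: "b * x + 1 \<noteq> 0"
  have "(a * y^3 + b^2 * y^2 + 2 * a * b * y + a^2) * (b * x + 1)^3 =
      a * (y * (b * x + 1))^3 + b^2 * (y * (b * x + 1))^2 * (b * x + 1) +
      2 * a * b * (y * (b * x + 1)) * (b * x + 1)^2 + a^2 * (b * x + 1)^3"
    unfolding power_mult_distrib by (simp add: distrib_right power2_eq_square power3_eq_cube mult.assoc)
  also have "\<dots> = - (a^2) * (a^2 * x^3 - b * x - 1)"
    unfolding xy by (simp add: algebra_simps power2_eq_square power3_eq_cube)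
  finally show "a^2 * x^3 - b * x - 1 = 0 \<longleftrightarrow> a * y^3 + b^2 * y^2 + 2 * a * b * y + a^2 = 0"
    using assms ne by (metis mult_eq_0_iff neg_equal_0_iff_equal power_not_zero)
qed

lemma V13_0: "V13 (0 :: 'k::field) = 2"
proof -
  have "x^2 + x - 0 = 0 \<longleftrightarrow> x = 0 \<or> x = - 1" for x :: 'k
  proof -
    have "x^2 + x - 0 = x * (x + 1)" by (simp add: algebra_simps power2_eq_square)
    then show ?thesis by (simp only: mult_eq_0_iff eq_neg_iff_add_eq_0)
  qed
  then have "{x::'k. x^2 + x - 0 = 0} = {0, - 1}" by auto
  then show ?thesis by (simp add: V13_def)
qed

section \<open>Assembling the zeta functions\<close>

lemma zeta_eqI:
  fixes L :: "'k::{field,finite} ^ 4 \<Rightarrow> 'k ^ 4 \<Rightarrow> 'k ^ 4" and s q t :: complex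
  defines "q \<equiv> of_nat CARD('k)"
  defines "t \<equiv> q powr (- s)"
  assumes "finite_field_lie_algebra (*s) cart_basis L"
    and "of_nat (count_codim L 1) = c1" "of_nat (count_codim L 2) = c2"
  shows "zeta L s = 1 + c1 * t + c2 * t^2 + (1 + q + q^2 + q^3) * t^3 + t^4"
  \<comment> \<open>Deleting \<open>One_nat_def\<close> keeps the codimension as the literal 1, the
    form in which the counts are stated.\<close>
  using assms by (simp add: zeta_eq del: One_nat_def)

theorem theorem1p9:
  fixes a b :: "'k::{field,finite}" and s q t :: complex
  defines "q \<equiv> of_nat CARD('k)"
  defines "t \<equiv> q powr (- s)"
  assumes "a \<noteq> 0" and "b \<noteq> 0"
  shows
    "zeta (M1 :: 'k ^ 4 \<Rightarrow> _) s =
       1 + (1 + q + q^2 + q^3) * t + (1 + q + q^2) * (1 + q^2) * t^2 + (1 + q + q^2 + q^3) * t^3 + t^4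
     \<and> zeta (M2 :: 'k ^ 4 \<Rightarrow> _) s =
       1 + (1 + q + q^2 + q^3) * t + (1 + q + q^2) * (1 + q^2) * t^2 + (1 + q + q^2 + q^3) * t^3 + t^4
     \<and> (a \<noteq> 1 \<longrightarrow> zeta (M3 a) s =
       1 + (q^2 + 2 * q + 1) * t + (q^3 + 3 * q^2 + q + 1) * t^2 + (1 + q + q^2 + q^3) * t^3 + t^4)
     \<and> zeta (M3 (1 :: 'k)) s =
       1 + (q^2 + q + 1) * t + (q^3 + 2 * q^2 + q + 1) * t^2 + (1 + q + q^2 + q^3) * t^3 + t^4
     \<and> zeta (M3 (0 :: 'k)) s =
       1 + (q^2 + 2 * q + 1) * t + (q^3 + 3 * q^2 + q + 1) * t^2 + (1 + q + q^2 + q^3) * t^3 + t^4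
     \<and> zeta (M4 :: 'k ^ 4 \<Rightarrow> _) s =
       1 + (q^2 + 2 * q + 1) * t + (q^3 + 3 * q^2 + q + 1) * t^2 + (1 + q + q^2 + q^3) * t^3 + t^4
     \<and> zeta (M5 :: 'k ^ 4 \<Rightarrow> _) s =
       1 + (q^2 + q + 1) * t + (q^3 + 2 * q^2 + q + 1) * t^2 + (1 + q + q^2 + q^3) * t^3 + t^4
     \<and> (a \<noteq> - b \<longrightarrow> zeta (M6 a b) s =
       1 + (1 + q * of_nat (V6_2 a b)) * t
       + (1 + q + q^2 + (q^2 - 1) * of_nat (V6_3 a b) + of_nat (V6_1 a b)) * t^2
       + (1 + q + q^2 + q^3) * t^3 + t^4)
     \<and> zeta (M6 a (- a)) s =
       1 + (1 + q * of_nat (V6_2 a (- a))) * t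
       + (1 + q + q^2 + (q^2 - 1) * (1 + of_nat (V6_4 a (- a))) + of_nat (V6_1 a (- a))) * t^2
       + (1 + q + q^2 + q^3) * t^3 + t^4
     \<and> zeta (M6 a 0) s =
       1 + (1 + q * of_nat (V6_2 a 0)) * t
       + (1 + q + q^2 + (q^2 - 1) * of_nat (V6_2 a 0) + of_nat (V6_1 a 0)) * t^2
       + (1 + q + q^2 + q^3) * t^3 + t^4
     \<and> zeta (M6 0 b) s =
       1 + (1 + q + q * of_nat (V3 b)) * t + (1 + q + 2 * q^2 + q^2 * of_nat (V3 b)) * t^2
       + (1 + q + q^2 + q^3) * t^3 + t^4
     \<and> zeta (M6 0 (0 :: 'k)) s =
       1 + (1 + 2 * q) * t + (1 + q + 3 * q^2) * t^2 + (1 + q + q^2 + q^3) * t^3 + t^4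
     \<and> zeta (M7 a b) s =
       1 + (1 + q * of_nat (V7_2 a b)) * t
       + (1 + q + q^2 + (q^2 - 1) * of_nat (V7_3 a b) + of_nat (V7_1 a b)) * t^2
       + (1 + q + q^2 + q^3) * t^3 + t^4
     \<and> zeta (M7 a 0) s =
       1 + (1 + q * of_nat (V7_2 a 0)) * t
       + (1 + q + q^2 + (q^2 - 1) * of_nat (V7_2 a 0) + of_nat (V7_1 a 0)) * t^2
       + (1 + q + q^2 + q^3) * t^3 + t^4
     \<and> zeta (M7 0 b) s =
       1 + (1 + q + q * of_nat (V4 b)) * t + (1 + q + 2 * q^2 + q^2 * of_nat (V4 b)) * t^2
       + (1 + q + q^2 + q^3) * t^3 + t^4
     \<and> zeta (M7 0 (0 :: 'k)) s =
       1 + (1 + q) * t + (1 + q + 2 * q^2) * t^2 + (1 + q + q^2 + q^3) * t^3 + t^4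
     \<and> zeta (M8 :: 'k ^ 4 \<Rightarrow> _) s =
       1 + (1 + 3 * q) * t + (1 + q + 4 * q^2) * t^2 + (1 + q + q^2 + q^3) * t^3 + t^4
     \<and> ((\<nexists>x. x^2 - x - a = 0) \<longrightarrow> zeta (M9 a) s =
       1 + (1 + q) * t + (1 + q + 2 * q^2) * t^2 + (1 + q + q^2 + q^3) * t^3 + t^4)
     \<and> zeta (M12 :: 'k ^ 4 \<Rightarrow> _) s =
       1 + (1 + q + q^2) * t + (1 + q + 2 * q^2 + q^3) * t^2 + (1 + q + q^2 + q^3) * t^3 + t^4
     \<and> zeta (M13 a) s =
       1 + (1 + q * of_nat (V13 a)) * t + (1 + q + q^2 + q^2 * of_nat (V13 a)) * t^2
       + (1 + q + q^2 + q^3) * t^3 + t^4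
     \<and> zeta (M13 (0 :: 'k)) s =
       1 + (2 * q + 1) * t + (3 * q^2 + q + 1) * t^2 + (1 + q + q^2 + q^3) * t^3 + t^4
     \<and> zeta (M14 a) s =
       1 + (1 + q * of_nat (V14 a)) * t + (1 + q + q^2 + q^2 * of_nat (V14 a)) * t^2
       + (1 + q + q^2 + q^3) * t^3 + t^4"
proof -
  note counts = counts_M1 counts_M2 counts_M3[OF \<open>a \<noteq> 0\<close>] counts_M3[OF one_neq_zero] counts_M3_0
    counts_M4 counts_M5 counts_M6[OF \<open>a \<noteq> 0\<close>] counts_M6_0[OF \<open>b \<noteq> 0\<close>] counts_M6_0_0
    counts_M7[OF \<open>a \<noteq> 0\<close>] counts_M7_0[OF \<open>b \<noteq> 0\<close>] counts_M7_0_0 counts_M8 counts_M12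
    counts_M13 counts_M14 V13_0
  \<comment> \<open>These equalities collapse (q^2 - 1) times one count plus the other into q^2
    times a single count.\<close>
  have "V6_3 a b = V6_1 a b" if "a \<noteq> - b"
    using V6_1_eq_V6_3[of a b] that \<open>a \<noteq> 0\<close> by (simp add: eq_neg_iff_add_eq_0)
  moreover have "V7_3 a b = V7_1 a b"
    using V7_1_eq_V7_3 \<open>a \<noteq> 0\<close> by metis
  moreover note V6_1_eq_V6_4[OF \<open>a \<noteq> 0\<close>] V6_1_eq_V6_2[OF \<open>a \<noteq> 0\<close>, of 0]
    V7_1_eq_V7_2[OF \<open>a \<noteq> 0\<close>, of 0]
  ultimately show ?thesis
    unfolding t_def q_def
    by (intro conjI impI zeta_eqI lie_algebra_M)
      (simp_all add: counts counts_M9 algebra_simps del: One_nat_def)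
qed

end
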